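(* Let $(\Sigma,\sigma,\tau)$ be a separating real curve with an involution, with the basis of cycles, the permutation $t$ and the Prym matrix $\Pi$ as in the context. Then $\Pi$ satisfies the following equivalent conditions: $1^\circ$. $\overline{\Pi_{pq}}=\Pi_{t(p),t(q)}$, $p,q=1,\dots,h$; $2^\circ$. $\overline{\Pi}=t\Pi t$, where (abusing notation) $t$ denotes the matrix given by the permutation $t$: $t_{pq}=\delta_{p,t(q)}$; $3^\circ$. $\overline{\Pi_q}=t\Pi_{t(q)}$, where $\Pi_q$ is the $q$-th column of $\Pi$.
   Context: A real curve with an involution is a compact nonsingular algebraic curve $\Sigma$ over $\mathbb{C}$ of genus $g$ with two commuting involutions: $\sigma$ holomorphic and $\tau$ antiholomorphic. Ovals are the connected components of the fixed point set of $\tau$; $(\Sigma,\tau)$ is separating if $\Sigma\setminus\bigcup\text{ovals}$ is not connected. Let $\Sigma_\sigma=\Sigma/\sigma$ have genus $g_\sigma$, let the branch divisor of $\Sigma\to\Sigma_\sigma$ have degree $2n$, and let $h=g_\sigma+n-1$, so $g=h+g_\sigma$. Basis of cycles: $\{a_j,b_j\}_{j=1}^g$ is a symplectic basis of cycles on $\Sigma$ with $\sigma(a_j)=-a_{s(j)}$, $\sigma(b_j)=-b_{s(j)}$, where $s$ is the permutation $(1,h+1)\cdots(g_\sigma,h+g_\sigma)(g_\sigma+1)\cdots(h)$; the cycles with indices $1,\dots,g_\sigma$ and $h+1,\dots,g$ are pulled back from $\Sigma_\sigma$. The basis is also real with respect to $\tau$, i.e. (up to numbering of the cycles) $\tau(a_j)=a_{t(j)}$,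 $\tau(b_j)=-b_{t(j)}$, where $t$ is the permutation of indices induced by $\tau$, $t^2=1$. Differentials: $w_1,\dots,w_g$ are the holomorphic differentials with $\int_{a_j}w_i=2\pi\mathrm{i}\,\delta_{ij}$. The normalized Prym differentials are $\omega_i=w_i+w_{i+h}$ for $1\le i\le g_\sigma$ and $\omega_i=w_i$ for $g_\sigma<i\le h$. The Prym matrix $\Pi$ is the $h\times h$ matrix with $\Pi_{ij}=\int_{b_j}\omega_i$ for $j\le g_\sigma$ and $\Pi_{ij}=\frac12\int_{b_j}\omega_i$ for $g_\sigma<j\le h$. Bars denote complex conjugation. *)

theory Defs
  imports
    "HOL-Complex_Analysis.Complex_Analysis"
    "HOL-Homology.Homology"
    "HOL-Combinatorics.Combinatorics"
    "HOL-Library.Function_Algebras"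
    "Jordan_Normal_Form.Matrix"
begin

section \<open>Compact Riemann surfaces\<close>

text \<open>A nonsingular compact algebraic curve over the complex numbers is treated as a compact
  connected Riemann surface: a topology with a holomorphic atlas. A chart is a pair
  \<open>(U, \<phi>)\<close>; only the values of \<open>\<phi>\<close> on \<open>U\<close> matter.\<close>

type_synonym 'a chart = "'a set \<times> ('a \<Rightarrow> complex)"

definition complex_atlas :: "'a topology \<Rightarrow> 'a chart set \<Rightarrow> bool" where
  "complex_atlas X A \<longleftrightarrow>
     (\<Union>(U, \<phi>)\<in>A. U) = topspace X \<and>
     (\<forall>(U, \<phi>)\<in>A. openin X U \<and> open (\<phi> ` U) \<and>
        homeomorphic_map (subtopology X U) (top_of_set (\<phi> ` U)) \<phi>) \<and>
     (\<forall>(U, \<phi>)\<in>A. \<forall>(V, \<psi>)\<in>A. (\<psi> \<circ> inv_into U \<phi>) holomorphic_on \<phi> ` (U \<inter> V))"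

definition compact_riemann_surface :: "'a topology \<Rightarrow> 'a chart set \<Rightarrow> bool" where
  "compact_riemann_surface X A \<longleftrightarrow>
     topspace X \<noteq> {} \<and> compact_space X \<and> Hausdorff_space X \<and> connected_space X \<and>
     complex_atlas X A"

definition holomorphic_map ::
  "'a topology \<Rightarrow> 'a chart set \<Rightarrow> 'b topology \<Rightarrow> 'b chart set \<Rightarrow> ('a \<Rightarrow> 'b) \<Rightarrow> bool" where
  "holomorphic_map X A Y B f \<longleftrightarrow>
     continuous_map X Y f \<and>
     (\<forall>(U, \<phi>)\<in>A. \<forall>(V, \<psi>)\<in>B. (\<psi> \<circ> f \<circ> inv_into U \<phi>) holomorphic_on \<phi> ` {x\<in>U. f x \<in> V})"

definition antiholomorphic_map ::
  "'a topology \<Rightarrow> 'a chart set \<Rightarrow> 'b topology \<Rightarrow> 'b chart set \<Rightarrow> ('a \<Rightarrow> 'b) \<Rightarrow> bool" where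
  "antiholomorphic_map X A Y B f \<longleftrightarrow>
     continuous_map X Y f \<and>
     (\<forall>(U, \<phi>)\<in>A. \<forall>(V, \<psi>)\<in>B. (cnj \<circ> \<psi> \<circ> f \<circ> inv_into U \<phi>) holomorphic_on \<phi> ` {x\<in>U. f x \<in> V})"

definition chart_at :: "'a chart set \<Rightarrow> 'a \<Rightarrow> 'a chart" where
  "chart_at A x = (SOME c. c \<in> A \<and> x \<in> fst c)"


section \<open>Holomorphic differentials and the genus\<close>

text \<open>A differential is given by its coefficients in all charts: on \<open>(U, \<phi>)\<close> with coordinate
  \<open>z = \<phi> x\<close> it is \<open>w (U, \<phi>) z dz\<close>. Coefficients are set to \<open>0\<close> where they have no meaning, so
  that equality of functions is equality of differentials.\<close>

type_synonym 'a differential = "'a chart \<Rightarrow> complex \<Rightarrow> complex"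

definition holomorphic_differential :: "'a chart set \<Rightarrow> 'a differential \<Rightarrow> bool" where
  "holomorphic_differential A w \<longleftrightarrow>
     (\<forall>(U, \<phi>)\<in>A. w (U, \<phi>) holomorphic_on \<phi> ` U) \<and>
     (\<forall>(U, \<phi>)\<in>A. \<forall>(V, \<psi>)\<in>A. \<forall>x\<in>U \<inter> V.
        w (U, \<phi>) (\<phi> x) = w (V, \<psi>) (\<psi> x) * deriv (\<psi> \<circ> inv_into U \<phi>) (\<phi> x)) \<and>
     (\<forall>U \<phi> z. (U, \<phi>) \<notin> A \<or> z \<notin> \<phi> ` U \<longrightarrow> w (U, \<phi>) z = 0)"

definition scale_differential :: "complex \<Rightarrow> 'a differential \<Rightarrow> 'a differential" where
  "scale_differential c w = (\<lambda>k z. c * w k z)"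

lemma vector_space_scale_differential:
  "vector_space (scale_differential :: complex \<Rightarrow> 'a differential \<Rightarrow> 'a differential)"
  by unfold_locales (auto simp: scale_differential_def fun_eq_iff algebra_simps)

definition genus :: "'a chart set \<Rightarrow> nat" where
  "genus A = vector_space.dim scale_differential (Collect (holomorphic_differential A))"


section \<open>Periods\<close>

text \<open>Cycles are singular 1-cycles with integer coefficients.
  The path of a singular 1-simplex runs from vertex 0 to vertex 1, so that the boundary
  of the simplex is its end point minus its starting point.\<close>

definition simplex_path :: "((nat \<Rightarrow> real) \<Rightarrow> 'a) \<Rightarrow> real \<Rightarrow> 'a" where
  "simplex_path f u = f (\<lambda>i. if i = 0 then 1 - u else if i = 1 then u else 0)"

definition local_primitive ::
  "'a chart set \<Rightarrow> 'a differential \<Rightarrow> 'a set \<Rightarrow> ('a \<Rightarrow> complex) \<Rightarrow> bool" where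
  "local_primitive A w W f \<longleftrightarrow>
     (\<forall>(U, \<phi>)\<in>A. \<forall>x\<in>U \<inter> W.
        ((f \<circ> inv_into U \<phi>) has_field_derivative w (U, \<phi>) (\<phi> x)) (at (\<phi> x)))"

text \<open>The integral of a holomorphic (hence closed) differential over a merely continuous path
  is the increment of a primitive along the path. On piecewise smooth paths this is
  the usual line integral.\<close>

definition primitive_along ::
  "'a topology \<Rightarrow> 'a chart set \<Rightarrow> 'a differential \<Rightarrow> (real \<Rightarrow> 'a) \<Rightarrow> (real \<Rightarrow> complex) \<Rightarrow> bool" where
  "primitive_along X A w \<gamma> F \<longleftrightarrow>
     (\<forall>u\<in>{0..1}. \<exists>W f. openin X W \<and> \<gamma> u \<in> W \<and> local_primitive A w W f \<and>
        (\<exists>e>0. \<forall>v\<in>{0..1}. \<bar>v - u\<bar> < e \<longrightarrow> \<gamma> v \<in> W \<and> F v = f (\<gamma> v)))"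

definition path_integral ::
  "'a topology \<Rightarrow> 'a chart set \<Rightarrow> 'a differential \<Rightarrow> (real \<Rightarrow> 'a) \<Rightarrow> complex" where
  "path_integral X A w \<gamma> = (THE I. \<exists>F. primitive_along X A w \<gamma> F \<and> I = F 1 - F 0)"

definition period ::
  "'a topology \<Rightarrow> 'a chart set \<Rightarrow> 'a chain \<Rightarrow> 'a differential \<Rightarrow> complex" where
  "period X A c w = (\<Sum>f\<in>Poly_Mapping.keys c.
     of_int (Poly_Mapping.lookup c f) * path_integral X A w (simplex_path f))"


section \<open>Symplectic bases of cycles\<close>

abbreviation cycle :: "'a topology \<Rightarrow> 'a chain \<Rightarrow> bool" where
  "cycle X \<equiv> singular_relcycle 1 X {}"

abbreviation homologous :: "'a topology \<Rightarrow> 'a chain \<Rightarrow> 'a chain \<Rightarrow> bool" where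
  "homologous X \<equiv> homologous_rel 1 X {}"

text \<open>The orientation number of the tangent vectors of \<open>\<gamma>\<close> and \<open>\<delta>\<close> at a crossing
  \<open>\<gamma> u = \<delta> v\<close> is the imaginary part of \<open>cnj \<gamma>' * \<delta>'\<close> in a local coordinate; its sign does not
  depend on the coordinate.\<close>

definition crossing_orientation ::
  "'a chart set \<Rightarrow> (real \<Rightarrow> 'a) \<Rightarrow> (real \<Rightarrow> 'a) \<Rightarrow> real \<Rightarrow> real \<Rightarrow> real" where
  "crossing_orientation A \<gamma> \<delta> u v = (let \<phi> = snd (chart_at A (\<gamma> u)) in
     Im (cnj (vector_derivative (\<phi> \<circ> \<gamma>) (at u)) * vector_derivative (\<phi> \<circ> \<delta>) (at v)))"

definition crossings :: "(real \<Rightarrow> 'a) \<Rightarrow> (real \<Rightarrow> 'a) \<Rightarrow> (real \<times> real) set" where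
  "crossings \<gamma> \<delta> = {(u, v) \<in> {0..1} \<times> {0..1}. \<gamma> u = \<delta> v}"

definition transverse :: "'a chart set \<Rightarrow> (real \<Rightarrow> 'a) \<Rightarrow> (real \<Rightarrow> 'a) \<Rightarrow> bool" where
  "transverse A \<gamma> \<delta> \<longleftrightarrow>
     (\<forall>(u, v)\<in>crossings \<gamma> \<delta>. 0 < u \<and> u < 1 \<and> 0 < v \<and> v < 1 \<and>
        (snd (chart_at A (\<gamma> u)) \<circ> \<gamma>) differentiable (at u) \<and>
        (snd (chart_at A (\<gamma> u)) \<circ> \<delta>) differentiable (at v) \<and>
        crossing_orientation A \<gamma> \<delta> u v \<noteq> 0)"

text \<open>At a transverse crossing the paths are not parallel, so crossings are isolated and,
  by compactness, finite in number.\<close>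

definition crossing_sum :: "'a chart set \<Rightarrow> 'a chain \<Rightarrow> 'a chain \<Rightarrow> int" where
  "crossing_sum A c d =
     (\<Sum>f\<in>Poly_Mapping.keys c. \<Sum>k\<in>Poly_Mapping.keys d.
        Poly_Mapping.lookup c f * Poly_Mapping.lookup d k *
        (\<Sum>(u, v)\<in>crossings (simplex_path f) (simplex_path k).
           if crossing_orientation A (simplex_path f) (simplex_path k) u v > 0 then 1 else - 1))"

text \<open>The intersection number of two homology classes is the signed number of crossings of
  any transverse representatives.\<close>

definition has_intersection_number ::
  "'a topology \<Rightarrow> 'a chart set \<Rightarrow> 'a chain \<Rightarrow> 'a chain \<Rightarrow> int \<Rightarrow> bool" where
  "has_intersection_number X A c d m \<longleftrightarrow>
     (\<exists>c' d'. homologous X c c' \<and> homologous X d d' \<and>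
        (\<forall>f\<in>Poly_Mapping.keys c'. \<forall>k\<in>Poly_Mapping.keys d'.
           transverse A (simplex_path f) (simplex_path k)) \<and>
        m = crossing_sum A c' d')"

definition cycle_combination ::
  "nat \<Rightarrow> (nat \<Rightarrow> 'a chain) \<Rightarrow> (nat \<Rightarrow> 'a chain) \<Rightarrow> (nat \<Rightarrow> int) \<Rightarrow> (nat \<Rightarrow> int) \<Rightarrow> 'a chain" where
  "cycle_combination g a b k l = (\<Sum>j<g. frag_cmul (k j) (a j) + frag_cmul (l j) (b j))"

text \<open>All families of cycles, differentials and matrix entries are numbered from 0.\<close>

definition symplectic_basis ::
  "'a topology \<Rightarrow> 'a chart set \<Rightarrow> nat \<Rightarrow> (nat \<Rightarrow> 'a chain) \<Rightarrow> (nat \<Rightarrow> 'a chain) \<Rightarrow> bool" where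
  "symplectic_basis X A g a b \<longleftrightarrow>
     (\<forall>j<g. cycle X (a j) \<and> cycle X (b j)) \<and>
     (\<forall>c. cycle X c \<longrightarrow> (\<exists>k l. homologous X c (cycle_combination g a b k l))) \<and>
     (\<forall>k l. homologous X (cycle_combination g a b k l) 0 \<longrightarrow> (\<forall>j<g. k j = 0 \<and> l j = 0)) \<and>
     (\<forall>i<g. \<forall>j<g.
        has_intersection_number X A (a i) (a j) 0 \<and>
        has_intersection_number X A (b i) (b j) 0 \<and>
        has_intersection_number X A (a i) (b j) (if i = j then 1 else 0))"


section \<open>Real curves with an involution\<close>

definition real_curve_with_involution ::
  "'a topology \<Rightarrow> 'a chart set \<Rightarrow> ('a \<Rightarrow> 'a) \<Rightarrow> ('a \<Rightarrow> 'a) \<Rightarrow> bool" where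
  "real_curve_with_involution X A \<sigma> \<tau> \<longleftrightarrow>
     compact_riemann_surface X A \<and>
     holomorphic_map X A X A \<sigma> \<and> (\<forall>x\<in>topspace X. \<sigma> (\<sigma> x) = x) \<and> (\<exists>x\<in>topspace X. \<sigma> x \<noteq> x) \<and>
     antiholomorphic_map X A X A \<tau> \<and> (\<forall>x\<in>topspace X. \<tau> (\<tau> x) = x) \<and>
     (\<forall>x\<in>topspace X. \<sigma> (\<tau> x) = \<tau> (\<sigma> x))"

definition ovals :: "'a topology \<Rightarrow> ('a \<Rightarrow> 'a) \<Rightarrow> 'a set set" where
  "ovals X \<tau> = connected_components_of (subtopology X {x\<in>topspace X. \<tau> x = x})"

definition separating :: "'a topology \<Rightarrow> ('a \<Rightarrow> 'a) \<Rightarrow> bool" where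
  "separating X \<tau> \<longleftrightarrow> \<not> connected_space (subtopology X (topspace X - \<Union> (ovals X \<tau>)))"

text \<open>These conditions determine the quotient Riemann surface \<open>(Y, B)\<close> and its projection \<open>\<pi>\<close>
  up to a unique isomorphism.\<close>

definition quotient_surface ::
  "'a topology \<Rightarrow> 'a chart set \<Rightarrow> ('a \<Rightarrow> 'a) \<Rightarrow>
   'b topology \<Rightarrow> 'b chart set \<Rightarrow> ('a \<Rightarrow> 'b) \<Rightarrow> bool" where
  "quotient_surface X A \<sigma> Y B \<pi> \<longleftrightarrow>
     compact_riemann_surface Y B \<and> holomorphic_map X A Y B \<pi> \<and>
     \<pi> ` topspace X = topspace Y \<and>
     (\<forall>x\<in>topspace X. \<forall>y\<in>topspace X. \<pi> x = \<pi> y \<longleftrightarrow> y = x \<or> y = \<sigma> x)"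

definition ramification_index ::
  "'a chart set \<Rightarrow> 'b chart set \<Rightarrow> ('a \<Rightarrow> 'b) \<Rightarrow> 'a \<Rightarrow> nat" where
  "ramification_index A B f x =
     (let (U, \<phi>) = chart_at A x; (V, \<psi>) = chart_at B (f x)
      in nat (zorder (\<lambda>z. \<psi> (f (inv_into U \<phi> z)) - \<psi> (f x)) (\<phi> x)))"

definition branch_divisor ::
  "'a topology \<Rightarrow> 'a chart set \<Rightarrow> 'b chart set \<Rightarrow> ('a \<Rightarrow> 'b) \<Rightarrow> 'b \<Rightarrow> nat" where
  "branch_divisor X A B f y =
     (\<Sum>x\<in>{x\<in>topspace X. f x = y}. ramification_index A B f x - 1)"

definition divisor_degree :: "'b topology \<Rightarrow> ('b \<Rightarrow> nat) \<Rightarrow> nat" where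
  "divisor_degree Y D = (\<Sum>y\<in>{y\<in>topspace Y. D y \<noteq> 0}. D y)"


section \<open>Bases of cycles adapted to the involutions\<close>

definition sigma_permutation :: "nat \<Rightarrow> nat \<Rightarrow> nat \<Rightarrow> (nat \<Rightarrow> nat) \<Rightarrow> bool" where
  "sigma_permutation g h g\<^sub>\<sigma> s \<longleftrightarrow>
     s permutes {..<g} \<and>
     (\<forall>j<g\<^sub>\<sigma>. s j = h + j \<and> s (h + j) = j) \<and>
     (\<forall>j. g\<^sub>\<sigma> \<le> j \<and> j < h \<longrightarrow> s j = j)"

definition sigma_adapted ::
  "'a topology \<Rightarrow> ('a \<Rightarrow> 'a) \<Rightarrow> nat \<Rightarrow> (nat \<Rightarrow> nat) \<Rightarrow> (nat \<Rightarrow> 'a chain) \<Rightarrow> (nat \<Rightarrow> 'a chain) \<Rightarrow> bool" where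
  "sigma_adapted X \<sigma> g s a b \<longleftrightarrow>
     (\<forall>j<g. homologous X (chain_map 1 \<sigma> (a j)) (- a (s j)) \<and>
            homologous X (chain_map 1 \<sigma> (b j)) (- b (s j)))"

text \<open>The two lifts of a cycle \<open>c j\<close> of the quotient are \<open>a j\<close> and
  \<open>- a (h + j)\<close>, which are interchanged by the holomorphic involution.\<close>

definition pulled_back ::
  "'b topology \<Rightarrow> 'b chart set \<Rightarrow> ('a \<Rightarrow> 'b) \<Rightarrow> nat \<Rightarrow> nat \<Rightarrow>
   (nat \<Rightarrow> 'a chain) \<Rightarrow> (nat \<Rightarrow> 'a chain) \<Rightarrow> bool" where
  "pulled_back Y B \<pi> h g\<^sub>\<sigma> a b \<longleftrightarrow>
     (\<exists>c d. symplectic_basis Y B g\<^sub>\<sigma> c d \<and>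
        (\<forall>j<g\<^sub>\<sigma>.
           homologous Y (chain_map 1 \<pi> (a j)) (c j) \<and>
           homologous Y (chain_map 1 \<pi> (b j)) (d j) \<and>
           homologous Y (chain_map 1 \<pi> (a (h + j))) (- c j) \<and>
           homologous Y (chain_map 1 \<pi> (b (h + j))) (- d j)))"

text \<open>The numbering is such that \<open>t\<close> also permutes the first \<open>h\<close> indices; otherwise its action
  on the rows and columns of an \<open>h \<times> h\<close> matrix would not be defined.\<close>

definition tau_adapted ::
  "'a topology \<Rightarrow> ('a \<Rightarrow> 'a) \<Rightarrow> nat \<Rightarrow> nat \<Rightarrow> (nat \<Rightarrow> nat) \<Rightarrow>
   (nat \<Rightarrow> 'a chain) \<Rightarrow> (nat \<Rightarrow> 'a chain) \<Rightarrow> bool" where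
  "tau_adapted X \<tau> g h t a b \<longleftrightarrow>
     t permutes {..<g} \<and> (\<forall>j<g. t (t j) = j) \<and> t ` {..<h} = {..<h} \<and>
     (\<forall>j<g. homologous X (chain_map 1 \<tau> (a j)) (a (t j)) \<and>
            homologous X (chain_map 1 \<tau> (b j)) (- b (t j)))"


section \<open>The Prym matrix\<close>

definition normalized_differentials ::
  "'a topology \<Rightarrow> 'a chart set \<Rightarrow> nat \<Rightarrow> (nat \<Rightarrow> 'a chain) \<Rightarrow> (nat \<Rightarrow> 'a differential) \<Rightarrow> bool" where
  "normalized_differentials X A g a w \<longleftrightarrow>
     (\<forall>i<g. holomorphic_differential A (w i)) \<and>
     (\<forall>i<g. \<forall>j<g. period X A (a j) (w i) = (if i = j then 2 * of_real pi * \<i> else 0))"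

definition prym_differential ::
  "nat \<Rightarrow> nat \<Rightarrow> (nat \<Rightarrow> 'a differential) \<Rightarrow> nat \<Rightarrow> 'a differential" where
  "prym_differential h g\<^sub>\<sigma> w i = (if i < g\<^sub>\<sigma> then w i + w (i + h) else w i)"

definition prym_matrix ::
  "'a topology \<Rightarrow> 'a chart set \<Rightarrow> nat \<Rightarrow> nat \<Rightarrow> (nat \<Rightarrow> 'a chain) \<Rightarrow>
   (nat \<Rightarrow> 'a differential) \<Rightarrow> complex Matrix.mat" where
  "prym_matrix X A h g\<^sub>\<sigma> b w = Matrix.mat h h (\<lambda>(i, j).
     if j < g\<^sub>\<sigma> then period X A (b j) (prym_differential h g\<^sub>\<sigma> w i)
     else period X A (b j) (prym_differential h g\<^sub>\<sigma> w i) / 2)"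

definition perm_matrix :: "nat \<Rightarrow> (nat \<Rightarrow> nat) \<Rightarrow> complex Matrix.mat" where
  "perm_matrix h t = Matrix.mat h h (\<lambda>(p, q). if p = t q then 1 else 0)"

definition entrywise_real :: "nat \<Rightarrow> (nat \<Rightarrow> nat) \<Rightarrow> complex Matrix.mat \<Rightarrow> bool" where
  "entrywise_real h t M \<longleftrightarrow> (\<forall>p<h. \<forall>q<h. cnj (M $$ (p, q)) = M $$ (t p, t q))"

definition matrix_real :: "nat \<Rightarrow> (nat \<Rightarrow> nat) \<Rightarrow> complex Matrix.mat \<Rightarrow> bool" where
  "matrix_real h t M \<longleftrightarrow> map_mat cnj M = perm_matrix h t * M * perm_matrix h t"

definition columnwise_real :: "nat \<Rightarrow> (nat \<Rightarrow> nat) \<Rightarrow> complex Matrix.mat \<Rightarrow> bool" where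
  "columnwise_real h t M \<longleftrightarrow>
     (\<forall>q<h. map_vec cnj (Matrix.col M q) = perm_matrix h t *\<^sub>v Matrix.col M (t q))"

end

theory Submission
  imports Defs
begin

text \<open>For a holomorphic differential \<open>w\<close> also \<open>cnj (\<tau>\<^sup>* w)\<close> is holomorphic, and its period
  over a cycle \<open>c\<close> is the conjugate of the period of \<open>w\<close> over \<open>\<tau> c\<close>. Comparing periods over
  the cycles \<open>a\<^sub>j\<close> gives \<open>cnj (\<tau>\<^sup>* w\<^sub>i) = - w\<^bsub>t(i)\<^esub>\<close>, and the periods over the \<open>b\<^sub>j\<close> then show that
  the full period matrix is conjugated by \<open>t\<close>. As \<open>\<sigma>\<close> and \<open>\<tau>\<close> commute, so do \<open>s\<close> and \<open>t\<close>
  by independence of the \<open>a\<^sub>j\<close> in homology; hence \<open>t\<close> preserves the first \<open>g\<^sub>\<sigma>\<close> indices,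
  \<open>t(i + h) = t(i) + h\<close> for these, and the property passes to the Prym matrix.

  Periods are invariant under homology because a differential pulled back to a square has a
  primitive there.\<close>

section \<open>Charts\<close>

text \<open>Singular simplices are merely continuous, so a period cannot be computed from the
  velocity of a path: every statement about periods is reduced to local primitives, glued over an
  interval or a square. The same device handles the conjugate pullback, whose coefficients depend on
  an arbitrary choice of a chart at each image point: exhibiting local primitives is enough to see
  that it is holomorphic. Two signs decide the result. Conjugation negates the normalising constant
  2 pi i, which causes the minus sign in the comparison over the a-cycles, and \<open>\<tau>\<close>
  reverses the b-cycles; on the b-periods the two cancel. The comparison rests on the fact that a
  holomorphic differential is determined by its a-periods, obtained from the genus by counting
  dimensions. That \<open>t\<close> keeps the first \<open>g\<^sub>\<sigma>\<close> indices comes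
  from the shape of \<open>s\<close>: it moves these beyond \<open>h\<close> but fixes those from
  \<open>g\<^sub>\<sigma>\<close> up to \<open>h\<close>, while \<open>t\<close> does not mix
  indices below \<open>h\<close> with the others.\<close>

lemma chart_openin: "complex_atlas X A \<Longrightarrow> (U, \<phi>) \<in> A \<Longrightarrow> openin X U"
  by (auto simp: complex_atlas_def)

lemma chart_homeomorphic:
  "complex_atlas X A \<Longrightarrow> (U, \<phi>) \<in> A \<Longrightarrow>
     homeomorphic_map (subtopology X U) (top_of_set (\<phi> ` U)) \<phi>"
  by (auto simp: complex_atlas_def)

lemma chart_subset: "complex_atlas X A \<Longrightarrow> (U, \<phi>) \<in> A \<Longrightarrow> U \<subseteq> topspace X"
  using chart_openin openin_subset by metis

lemma chart_inj_on:
  assumes "complex_atlas X A" "(U, \<phi>) \<in> A"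
  shows "inj_on \<phi> U"
  using homeomorphic_imp_injective_map[OF chart_homeomorphic[OF assms]] chart_subset[OF assms]
  by (simp add: Int_absorb1)

lemma chart_inv_into:
  assumes "complex_atlas X A" "(U, \<phi>) \<in> A" "x \<in> U"
  shows "inv_into U \<phi> (\<phi> x) = x"
  using chart_inj_on[OF assms(1,2)] assms(3) by simp

lemma chart_open_image:
  assumes "complex_atlas X A" "(U, \<phi>) \<in> A" "openin X W"
  shows "open (\<phi> ` (U \<inter> W))"
proof -
  have "openin (subtopology X U) (U \<inter> W)"
    using assms(3) openin_subtopology_Int2 by blast
  then have "openin (top_of_set (\<phi> ` U)) (\<phi> ` (U \<inter> W))"
    using homeomorphic_imp_open_map[OF chart_homeomorphic[OF assms(1,2)]] by (simp add: open_map_def)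
  moreover have "open (\<phi> ` U)"
    using assms(1,2) by (auto simp: complex_atlas_def)
  ultimately show ?thesis
    using openin_open_trans by blast
qed

lemma chart_openin_preimage:
  assumes "complex_atlas X A" "(U, \<phi>) \<in> A" "open S"
  shows "openin X {x \<in> U. \<phi> x \<in> S}"
proof -
  have "openin (top_of_set (\<phi> ` U)) (\<phi> ` U \<inter> S)"
    using assms(3) by (simp add: openin_open_Int)
  then have "openin (subtopology X U) {x \<in> topspace (subtopology X U). \<phi> x \<in> \<phi> ` U \<inter> S}"
    using homeomorphic_imp_continuous_map[OF chart_homeomorphic[OF assms(1,2)]]
      openin_continuous_map_preimage by blast
  moreover have "{x \<in> topspace (subtopology X U). \<phi> x \<in> \<phi> ` U \<inter> S} = {x \<in> U. \<phi> x \<in> S}"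
    using chart_subset[OF assms(1,2)] by auto
  ultimately show ?thesis
    using openin_trans_full chart_openin[OF assms(1,2)] by metis
qed

lemma chart_at_mem:
  assumes "complex_atlas X A" "x \<in> topspace X"
  shows "chart_at A x \<in> A" "x \<in> fst (chart_at A x)"
proof -
  have "x \<in> (\<Union>(U, \<phi>)\<in>A. U)"
    using assms by (simp add: complex_atlas_def)
  then have "\<exists>c. c \<in> A \<and> x \<in> fst c" by fastforce
  from someI_ex[OF this] show "chart_at A x \<in> A" "x \<in> fst (chart_at A x)"
    by (auto simp: chart_at_def)
qed

lemma chart_cover:
  assumes "complex_atlas X A" "x \<in> topspace X"
  obtains U \<phi> where "(U, \<phi>) \<in> A" "x \<in> U"
  using chart_at_mem[OF assms] by (metis prod.collapse)

section \<open>Differentials and their primitives\<close>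

lemma holomorphic_differential_transition:
  assumes "holomorphic_differential A w" "(U, \<phi>) \<in> A" "(V, \<psi>) \<in> A" "x \<in> U" "x \<in> V"
  shows "w (U, \<phi>) (\<phi> x) = w (V, \<psi>) (\<psi> x) * deriv (\<psi> \<circ> inv_into U \<phi>) (\<phi> x)"
proof -
  have "\<forall>(U, \<phi>)\<in>A. \<forall>(V, \<psi>)\<in>A. \<forall>x\<in>U \<inter> V.
      w (U, \<phi>) (\<phi> x) = w (V, \<psi>) (\<psi> x) * deriv (\<psi> \<circ> inv_into U \<phi>) (\<phi> x)"
    using assms(1) unfolding holomorphic_differential_def by (elim conjE)
  from bspec[OF this assms(2)] have "\<forall>(V, \<psi>)\<in>A. \<forall>x\<in>U \<inter> V.
      w (U, \<phi>) (\<phi> x) = w (V, \<psi>) (\<psi> x) * deriv (\<psi> \<circ> inv_into U \<phi>) (\<phi> x)"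
    unfolding prod.case .
  from bspec[OF this assms(3)] have "\<forall>x\<in>U \<inter> V.
      w (U, \<phi>) (\<phi> x) = w (V, \<psi>) (\<psi> x) * deriv (\<psi> \<circ> inv_into U \<phi>) (\<phi> x)"
    unfolding prod.case .
  then show ?thesis
    using assms(4,5) by blast
qed

lemma holomorphic_differentialI:
  assumes "\<And>U \<phi>. (U, \<phi>) \<in> A \<Longrightarrow> w (U, \<phi>) holomorphic_on \<phi> ` U"
    and "\<And>U \<phi> V \<psi> x. (U, \<phi>) \<in> A \<Longrightarrow> (V, \<psi>) \<in> A \<Longrightarrow> x \<in> U \<Longrightarrow> x \<in> V \<Longrightarrow>
      w (U, \<phi>) (\<phi> x) = w (V, \<psi>) (\<psi> x) * deriv (\<psi> \<circ> inv_into U \<phi>) (\<phi> x)"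
    and "\<And>U \<phi> z. (U, \<phi>) \<notin> A \<or> z \<notin> \<phi> ` U \<Longrightarrow> w (U, \<phi>) z = 0"
  shows "holomorphic_differential A w"
  unfolding holomorphic_differential_def
proof (intro conjI)
  show "\<forall>(U, \<phi>)\<in>A. w (U, \<phi>) holomorphic_on \<phi> ` U"
    using assms(1) by (clarify)
  show "\<forall>(U, \<phi>)\<in>A. \<forall>(V, \<psi>)\<in>A. \<forall>x\<in>U \<inter> V.
      w (U, \<phi>) (\<phi> x) = w (V, \<psi>) (\<psi> x) * deriv (\<psi> \<circ> inv_into U \<phi>) (\<phi> x)"
    by clarify (rule assms(2))
  show "\<forall>U \<phi> z. (U, \<phi>) \<notin> A \<or> z \<notin> \<phi> ` U \<longrightarrow> w (U, \<phi>) z = 0"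
    using assms(3) by blast
qed

lemma holomorphic_differential_holomorphic_on:
  assumes "holomorphic_differential A w" "(U, \<phi>) \<in> A"
  shows "w (U, \<phi>) holomorphic_on \<phi> ` U"
proof -
  have "\<forall>(U, \<phi>)\<in>A. w (U, \<phi>) holomorphic_on \<phi> ` U"
    using assms(1) unfolding holomorphic_differential_def by (elim conjE)
  from bspec[OF this assms(2)] show ?thesis
    unfolding prod.case .
qed

lemma holomorphic_differential_eq_0:
  assumes "holomorphic_differential A w" "(U, \<phi>) \<notin> A \<or> z \<notin> \<phi> ` U"
  shows "w (U, \<phi>) z = 0"
proof -
  have "\<forall>U \<phi> z. (U, \<phi>) \<notin> A \<or> z \<notin> \<phi> ` U \<longrightarrow> w (U, \<phi>) z = 0"
    using assms(1) unfolding holomorphic_differential_def by (elim conjE)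
  then show ?thesis using assms(2) by blast
qed

section \<open>The complex vector space of holomorphic differentials\<close>

lemma holomorphic_differential_zero: "holomorphic_differential A 0"
  by (rule holomorphic_differentialI) (simp_all add: zero_fun_def)

lemma holomorphic_differential_add:
  assumes w: "holomorphic_differential A w" and w': "holomorphic_differential A w'"
  shows "holomorphic_differential A (w + w')"
proof (rule holomorphic_differentialI)
  fix U \<phi> assume U: "(U, \<phi>) \<in> A"
  show "(w + w') (U, \<phi>) holomorphic_on \<phi> ` U"
    using holomorphic_on_add[OF holomorphic_differential_holomorphic_on[OF w U]
        holomorphic_differential_holomorphic_on[OF w' U]]
    by (simp add: plus_fun_def)
next
  fix U \<phi> V \<psi> x assume *: "(U, \<phi>) \<in> A" "(V, \<psi>) \<in> A" "x \<in> U" "x \<in> V"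
  show "(w + w') (U, \<phi>) (\<phi> x) = (w + w') (V, \<psi>) (\<psi> x) * deriv (\<psi> \<circ> inv_into U \<phi>) (\<phi> x)"
    using holomorphic_differential_transition[OF w *] holomorphic_differential_transition[OF w' *]
    by (simp add: distrib_right)
next
  fix U \<phi> z assume *: "(U, \<phi>) \<notin> A \<or> z \<notin> \<phi> ` U"
  show "(w + w') (U, \<phi>) z = 0"
    using holomorphic_differential_eq_0[OF w *] holomorphic_differential_eq_0[OF w' *] by simp
qed

lemma holomorphic_differential_scale:
  assumes w: "holomorphic_differential A w"
  shows "holomorphic_differential A (scale_differential c w)"
proof (rule holomorphic_differentialI)
  fix U \<phi> assume U: "(U, \<phi>) \<in> A"
  show "scale_differential c w (U, \<phi>) holomorphic_on \<phi> ` U"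
    using holomorphic_on_mult[OF holomorphic_on_const holomorphic_differential_holomorphic_on[OF w U]]
    by (simp add: scale_differential_def)
next
  fix U \<phi> V \<psi> x assume *: "(U, \<phi>) \<in> A" "(V, \<psi>) \<in> A" "x \<in> U" "x \<in> V"
  show "scale_differential c w (U, \<phi>) (\<phi> x) =
      scale_differential c w (V, \<psi>) (\<psi> x) * deriv (\<psi> \<circ> inv_into U \<phi>) (\<phi> x)"
    using holomorphic_differential_transition[OF w *] by (simp add: scale_differential_def)
next
  fix U \<phi> z assume *: "(U, \<phi>) \<notin> A \<or> z \<notin> \<phi> ` U"
  show "scale_differential c w (U, \<phi>) z = 0"
    using holomorphic_differential_eq_0[OF w *] by (simp add: scale_differential_def)
qed

section \<open>Local primitives: linearity, existence and uniqueness\<close>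

lemma local_primitiveD:
  assumes "local_primitive A w W f" "(U, \<phi>) \<in> A" "x \<in> U" "x \<in> W"
  shows "((f \<circ> inv_into U \<phi>) has_field_derivative w (U, \<phi>) (\<phi> x)) (at (\<phi> x))"
  using assms unfolding local_primitive_def by blast

lemma local_primitive_subset:
  "local_primitive A w W f \<Longrightarrow> V \<subseteq> W \<Longrightarrow> local_primitive A w V f"
  unfolding local_primitive_def by blast

lemma local_primitive_add:
  assumes "local_primitive A w W f" "local_primitive A w' W f'"
  shows "local_primitive A (w + w') W (\<lambda>x. f x + f' x)"
  unfolding local_primitive_def
proof (clarify)
  fix U \<phi> x assume *: "(U, \<phi>) \<in> A" "x \<in> U" "x \<in> W"
  show "((\<lambda>x. f x + f' x) \<circ> inv_into U \<phi> has_field_derivative (w + w') (U, \<phi>) (\<phi> x)) (at (\<phi> x))"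
    using DERIV_add[OF local_primitiveD[OF assms(1) *] local_primitiveD[OF assms(2) *]]
    by (simp add: o_def)
qed

lemma local_primitive_scale:
  assumes "local_primitive A w W f"
  shows "local_primitive A (scale_differential c w) W (\<lambda>x. c * f x)"
  unfolding local_primitive_def
proof (clarify)
  fix U \<phi> x assume *: "(U, \<phi>) \<in> A" "x \<in> U" "x \<in> W"
  show "((\<lambda>x. c * f x) \<circ> inv_into U \<phi> has_field_derivative scale_differential c w (U, \<phi>) (\<phi> x)) (at (\<phi> x))"
    using DERIV_cmult[OF local_primitiveD[OF assms *]]
    by (simp add: o_def scale_differential_def)
qed

lemma local_primitive_shift:
  assumes "local_primitive A w W f"
  shows "local_primitive A w W (\<lambda>x. f x + c)"
  unfolding local_primitive_def
proof (clarify)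
  fix U \<phi> x assume *: "(U, \<phi>) \<in> A" "x \<in> U" "x \<in> W"
  show "((\<lambda>x. f x + c) \<circ> inv_into U \<phi> has_field_derivative w (U, \<phi>) (\<phi> x)) (at (\<phi> x))"
    using DERIV_add[OF local_primitiveD[OF assms *] DERIV_const]
    by (simp add: o_def)
qed

lemma transition_has_field_derivative:
  assumes at: "complex_atlas X A" and U: "(U, \<phi>) \<in> A" and V: "(V, \<psi>) \<in> A" and x: "x \<in> U" "x \<in> V"
  shows "((\<psi> \<circ> inv_into U \<phi>) has_field_derivative deriv (\<psi> \<circ> inv_into U \<phi>) (\<phi> x)) (at (\<phi> x))"
proof (rule holomorphic_derivI)
  show "(\<psi> \<circ> inv_into U \<phi>) holomorphic_on \<phi> ` (U \<inter> V)"
    using at U V by (fastforce simp: complex_atlas_def)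
  show "open (\<phi> ` (U \<inter> V))"
    by (intro chart_open_image[OF at U] chart_openin[OF at V])
  show "\<phi> x \<in> \<phi> ` (U \<inter> V)"
    using x by blast
qed

text \<open>In a chart the point has a disc around it, and a holomorphic function on a convex open
  set has a primitive. The chain rule through the transition map, matched with the transformation
  law of the coefficients, makes this a primitive in every other chart too.\<close>

lemma local_primitive_exists:
  assumes at: "complex_atlas X A" and w: "holomorphic_differential A w" and x: "x \<in> topspace X"
  obtains W f where "openin X W" "x \<in> W" "local_primitive A w W f"
proof -
  obtain U \<phi> where U: "(U, \<phi>) \<in> A" "x \<in> U"
    using chart_cover[OF at x] .
  have "open (\<phi> ` (U \<inter> U))"
    using chart_open_image[OF at U(1)] chart_openin[OF at U(1)] by blast
  then obtain r where r: "r > 0" "ball (\<phi> x) r \<subseteq> \<phi> ` U"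
    using U(2) by (metis Int_absorb imageI openE)
  have "w (U, \<phi>) holomorphic_on \<phi> ` U"
    using w U unfolding holomorphic_differential_def by fast
  then have "w (U, \<phi>) holomorphic_on ball (\<phi> x) r"
    using r(2) by (rule holomorphic_on_subset)
  then obtain p where "\<And>z. z \<in> ball (\<phi> x) r \<Longrightarrow>
      (p has_field_derivative w (U, \<phi>) z) (at z within ball (\<phi> x) r)"
    using holomorphic_convex_primitive'[OF convex_ball open_ball] by metis
  then have p: "(p has_field_derivative w (U, \<phi>) z) (at z)" if "z \<in> ball (\<phi> x) r" for z
    using that by (metis at_within_open open_ball)
  let ?W = "{y \<in> U. \<phi> y \<in> ball (\<phi> x) r}"
  have "local_primitive A w ?W (p \<circ> \<phi>)"
    unfolding local_primitive_def
  proof clarify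
    fix V \<psi> y assume V: "(V, \<psi>) \<in> A" "y \<in> V" "y \<in> U" "\<phi> y \<in> ball (\<phi> x) r"
    have "((\<phi> \<circ> inv_into V \<psi>) has_field_derivative deriv (\<phi> \<circ> inv_into V \<psi>) (\<psi> y)) (at (\<psi> y))"
      using transition_has_field_derivative[OF at V(1) U(1) V(2,3)] .
    moreover have "(\<phi> \<circ> inv_into V \<psi>) (\<psi> y) = \<phi> y"
      using chart_inv_into[OF at V(1,2)] by simp
    ultimately have "((p \<circ> (\<phi> \<circ> inv_into V \<psi>)) has_field_derivative
        w (U, \<phi>) (\<phi> y) * deriv (\<phi> \<circ> inv_into V \<psi>) (\<psi> y)) (at (\<psi> y))"
      using DERIV_chain[of p "w (U, \<phi>) (\<phi> y)" "\<phi> \<circ> inv_into V \<psi>" "\<psi> y"] p[OF V(4)] by simp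
    moreover have "w (V, \<psi>) (\<psi> y) = w (U, \<phi>) (\<phi> y) * deriv (\<phi> \<circ> inv_into V \<psi>) (\<psi> y)"
      using holomorphic_differential_transition[OF w V(1) U(1)] V by blast
    ultimately show "(p \<circ> \<phi> \<circ> inv_into V \<psi> has_field_derivative w (V, \<psi>) (\<psi> y)) (at (\<psi> y))"
      by (simp add: o_assoc)
  qed
  moreover have "openin X ?W"
    using chart_openin_preimage[OF at U(1)] by blast
  ultimately show ?thesis
    using that U r by auto
qed

text \<open>Read in one chart, the difference of the two functions has derivative 0 on a disc inside
  the overlap, hence is constant there, with value 0 at \<open>x\<close>. Agreement is claimed only
  near \<open>x\<close> because the overlap itself may be disconnected.\<close>

lemma local_primitive_agree:
  assumes at: "complex_atlas X A"
    and W: "openin X W" "openin X W'" "x \<in> W" "x \<in> W'"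
    and f: "local_primitive A w W f" "local_primitive A w W' f'" "f x = f' x"
  obtains V where "openin X V" "x \<in> V" "V \<subseteq> W \<inter> W'" "\<forall>y\<in>V. f y = f' y"
proof -
  have "x \<in> topspace X" using W openin_subset by blast
  then obtain U \<phi> where U: "(U, \<phi>) \<in> A" "x \<in> U"
    using chart_cover[OF at] by blast
  have WW: "openin X (W \<inter> W')" using W by blast
  have "open (\<phi> ` (U \<inter> (W \<inter> W')))"
    using chart_open_image[OF at U(1) WW] .
  then obtain r where r: "r > 0" "ball (\<phi> x) r \<subseteq> \<phi> ` (U \<inter> (W \<inter> W'))"
    using U(2) W by (metis IntI imageI openE)
  let ?d = "\<lambda>z. (f \<circ> inv_into U \<phi>) z - (f' \<circ> inv_into U \<phi>) z"
  have "(?d has_field_derivative 0) (at z within ball (\<phi> x) r)" if "z \<in> ball (\<phi> x) r" for z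
  proof -
    have "z \<in> \<phi> ` (U \<inter> (W \<inter> W'))"
      using that r(2) by blast
    then obtain y where y: "y \<in> U" "y \<in> W" "y \<in> W'" "z = \<phi> y"
      by blast
    have "(?d has_field_derivative w (U, \<phi>) (\<phi> y) - w (U, \<phi>) (\<phi> y)) (at (\<phi> y))"
      by (intro DERIV_diff local_primitiveD[OF f(1) U(1)] local_primitiveD[OF f(2) U(1)] y)
    then show ?thesis
      using y(4) by (simp add: has_field_derivative_at_within)
  qed
  then obtain c where c: "\<And>z. z \<in> ball (\<phi> x) r \<Longrightarrow> ?d z = c"
    using has_field_derivative_zero_constant[OF convex_ball, of "\<phi> x" r ?d] by blast
  have "c = 0"
    using c[of "\<phi> x"] r(1) f(3) chart_inv_into[OF at U] by simp
  let ?V = "{y \<in> U. \<phi> y \<in> ball (\<phi> x) r} \<inter> (W \<inter> W')"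
  show ?thesis
  proof
    show "openin X ?V"
      by (intro openin_Int chart_openin_preimage[OF at U(1)] W open_ball)
    show "x \<in> ?V" using U W r by simp
    show "\<forall>y\<in>?V. f y = f' y"
    proof
      fix y assume y: "y \<in> ?V"
      then have "?d (\<phi> y) = 0"
        using c[of "\<phi> y"] \<open>c = 0\<close> by blast
      then show "f y = f' y"
        using y chart_inv_into[OF at U(1), of y] by simp
    qed
  qed auto
qed

text \<open>The coefficient is locally the derivative of a holomorphic function, hence holomorphic;
  differentiating one primitive in two charts gives the transformation law, since derivatives are
  unique. This spares a direct check of the law when coefficients involve arbitrarily chosen
  charts.\<close>

lemma holomorphic_differential_if_local_primitives:
  assumes at: "complex_atlas X A"
    and prim: "\<And>x. x \<in> topspace X \<Longrightarrow> \<exists>W f. openin X W \<and> x \<in> W \<and> local_primitive A w W f"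
    and zero: "\<And>U \<phi> z. (U, \<phi>) \<notin> A \<or> z \<notin> \<phi> ` U \<Longrightarrow> w (U, \<phi>) z = 0"
  shows "holomorphic_differential A w"
  unfolding holomorphic_differential_def
proof (intro conjI)
  show "\<forall>(U, \<phi>)\<in>A. w (U, \<phi>) holomorphic_on \<phi> ` U"
  proof clarify
    fix U \<phi> assume U: "(U, \<phi>) \<in> A"
    have "w (U, \<phi>) field_differentiable at (\<phi> x)" if "x \<in> U" for x
    proof -
      obtain W f where W: "openin X W" "x \<in> W" "local_primitive A w W f"
        using prim chart_subset[OF at U] \<open>x \<in> U\<close> by blast
      have op: "open (\<phi> ` (U \<inter> W))"
        using chart_open_image[OF at U W(1)] .
      have d: "((f \<circ> inv_into U \<phi>) has_field_derivative w (U, \<phi>) z) (at z)" if "z \<in> \<phi> ` (U \<inter> W)" for z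
        using that local_primitiveD[OF W(3) U] by blast
      then have "(f \<circ> inv_into U \<phi>) holomorphic_on \<phi> ` (U \<inter> W)"
        using op holomorphic_on_open by blast
      then have "deriv (f \<circ> inv_into U \<phi>) holomorphic_on \<phi> ` (U \<inter> W)"
        using op holomorphic_deriv by blast
      moreover have "deriv (f \<circ> inv_into U \<phi>) z = w (U, \<phi>) z" if "z \<in> \<phi> ` (U \<inter> W)" for z
        using DERIV_imp_deriv[OF d[OF that]] .
      ultimately have "w (U, \<phi>) holomorphic_on \<phi> ` (U \<inter> W)"
        using holomorphic_transform by blast
      then show ?thesis
        using op \<open>x \<in> U\<close> W(2) by (metis IntI holomorphic_on_imp_differentiable_at imageI)
    qed
    then show "w (U, \<phi>) holomorphic_on \<phi> ` U"
      unfolding holomorphic_on_def using field_differentiable_at_within by blast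
  qed
  show "\<forall>(U, \<phi>)\<in>A. \<forall>(V, \<psi>)\<in>A. \<forall>x\<in>U \<inter> V.
       w (U, \<phi>) (\<phi> x) = w (V, \<psi>) (\<psi> x) * deriv (\<psi> \<circ> inv_into U \<phi>) (\<phi> x)"
  proof clarify
    fix U \<phi> V \<psi> x assume U: "(U, \<phi>) \<in> A" and V: "(V, \<psi>) \<in> A" and x: "x \<in> U" "x \<in> V"
    obtain W f where W: "openin X W" "x \<in> W" "local_primitive A w W f"
      using prim chart_subset[OF at U] \<open>x \<in> U\<close> by blast
    have "((f \<circ> inv_into V \<psi>) has_field_derivative w (V, \<psi>) (\<psi> x)) (at ((\<psi> \<circ> inv_into U \<phi>) (\<phi> x)))"
      using local_primitiveD[OF W(3) V x(2) W(2)] chart_inv_into[OF at U x(1)] by simp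
    from DERIV_chain[OF this transition_has_field_derivative[OF at U V x]]
    have "((f \<circ> inv_into V \<psi> \<circ> (\<psi> \<circ> inv_into U \<phi>)) has_field_derivative
        w (V, \<psi>) (\<psi> x) * deriv (\<psi> \<circ> inv_into U \<phi>) (\<phi> x)) (at (\<phi> x))" .
    then have "((f \<circ> inv_into U \<phi>) has_field_derivative
        w (V, \<psi>) (\<psi> x) * deriv (\<psi> \<circ> inv_into U \<phi>) (\<phi> x)) (at (\<phi> x))"
    proof (rule has_field_derivative_transform_within_open)
      show "open (\<phi> ` (U \<inter> V))"
        by (intro chart_open_image[OF at U] chart_openin[OF at V])
      show "\<phi> x \<in> \<phi> ` (U \<inter> V)" using x by blast
      fix z assume "z \<in> \<phi> ` (U \<inter> V)"
      then show "(f \<circ> inv_into V \<psi> \<circ> (\<psi> \<circ> inv_into U \<phi>)) z = (f \<circ> inv_into U \<phi>) z"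
        using chart_inv_into[OF at U] chart_inv_into[OF at V] by auto
    qed
    then show "w (U, \<phi>) (\<phi> x) = w (V, \<psi>) (\<psi> x) * deriv (\<psi> \<circ> inv_into U \<phi>) (\<phi> x)"
      using DERIV_unique local_primitiveD[OF W(3) U x(1) W(2)] by blast
  qed
qed (use zero in blast)

text \<open>The differential \<open>cnj (f\<^sup>* w)\<close> of an antiholomorphic \<open>f\<close>. If \<open>f\<close> reads \<open>cnj \<circ> k\<close> in charts with
  \<open>k\<close> holomorphic, then \<open>f\<^sup>* (u dz) = u (cnj k) d(cnj k)\<close>, and conjugation yields the
  coefficient \<open>cnj (u (cnj k)) * k'\<close>.\<close>

definition conjugate_pullback ::
  "'a chart set \<Rightarrow> 'b chart set \<Rightarrow> ('a \<Rightarrow> 'b) \<Rightarrow> 'b differential \<Rightarrow> 'a differential" where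
  "conjugate_pullback A B f w = (\<lambda>(U, \<phi>) z.
     if (U, \<phi>) \<in> A \<and> z \<in> \<phi> ` U then
       (let x = inv_into U \<phi> z; (V, \<psi>) = chart_at B (f x)
        in cnj (w (V, \<psi>) (\<psi> (f x))) * deriv (cnj \<circ> \<psi> \<circ> f \<circ> inv_into U \<phi>) z)
     else 0)"

text \<open>With \<open>p\<close> read in a target chart, \<open>cnj \<circ> p \<circ> f\<close> is
  the holomorphic function \<open>cnj \<circ> p \<circ> cnj\<close> applied after the holomorphic
  \<open>cnj \<circ> \<psi> \<circ> f\<close>, and the chain rule produces the coefficient of the
  pullback.\<close>

lemma local_primitive_conjugate_pullback:
  assumes at: "complex_atlas X A" and bt: "complex_atlas Y B"
    and anti: "antiholomorphic_map X A Y B f"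
    and W: "openin Y W" and p: "local_primitive B w W p"
  shows "local_primitive A (conjugate_pullback A B f w) {x \<in> topspace X. f x \<in> W} (cnj \<circ> p \<circ> f)"
  unfolding local_primitive_def
proof clarify
  fix U \<phi> x assume U: "(U, \<phi>) \<in> A" and x: "x \<in> U" "x \<in> topspace X" "f x \<in> W"
  have cont: "continuous_map X Y f"
    using anti by (simp add: antiholomorphic_map_def)
  then have fx: "f x \<in> topspace Y"
    using x(2) continuous_map_image_subset_topspace by fastforce
  \<comment> \<open>This is the chart by which \<open>conjugate_pullback\<close> defines its value
    at \<open>x\<close>. It may vary with \<open>x\<close>, which is harmless because the derivative
    is tested at one point at a time.\<close>
  obtain V \<psi> where c: "chart_at B (f x) = (V, \<psi>)" by force
  then have V: "(V, \<psi>) \<in> B" "f x \<in> V"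
    using chart_at_mem[OF bt fx] by auto
  let ?k = "cnj \<circ> \<psi> \<circ> f \<circ> inv_into U \<phi>"
  have "openin X {y \<in> topspace X. f y \<in> V}"
    using openin_continuous_map_preimage[OF cont chart_openin[OF bt V(1)]] .
  then have "open (\<phi> ` (U \<inter> {y \<in> topspace X. f y \<in> V}))"
    using chart_open_image[OF at U] by blast
  moreover have "U \<inter> {y \<in> topspace X. f y \<in> V} = {y \<in> U. f y \<in> V}"
    using chart_subset[OF at U] by blast
  ultimately have op: "open (\<phi> ` {y \<in> U. f y \<in> V})"
    by simp
  have hol: "?k holomorphic_on \<phi> ` {y \<in> U. f y \<in> V}"
    using anti U V unfolding antiholomorphic_map_def by fast
  have mem: "\<phi> x \<in> \<phi> ` {y \<in> U. f y \<in> V}" using x V by blast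
  have k: "(?k has_field_derivative deriv ?k (\<phi> x)) (at (\<phi> x))"
    using holomorphic_derivI[OF hol op mem] .
  have kx: "?k (\<phi> x) = cnj (\<psi> (f x))"
    using chart_inv_into[OF at U x(1)] by simp
  have "((p \<circ> inv_into V \<psi>) has_field_derivative w (V, \<psi>) (\<psi> (f x))) (at (cnj (?k (\<phi> x))))"
    using local_primitiveD[OF p V x(3)] kx by simp
  from DERIV_chain[OF has_field_derivative_cnj_cnj[OF this] k]
  have "((cnj \<circ> (p \<circ> inv_into V \<psi>) \<circ> cnj \<circ> ?k) has_field_derivative
      cnj (w (V, \<psi>) (\<psi> (f x))) * deriv ?k (\<phi> x)) (at (\<phi> x))" .
  then have "((cnj \<circ> p \<circ> f \<circ> inv_into U \<phi>) has_field_derivative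
      cnj (w (V, \<psi>) (\<psi> (f x))) * deriv ?k (\<phi> x)) (at (\<phi> x))"
  proof (rule has_field_derivative_transform_within_open[OF _ op mem])
    fix z assume "z \<in> \<phi> ` {y \<in> U. f y \<in> V}"
    then show "(cnj \<circ> (p \<circ> inv_into V \<psi>) \<circ> cnj \<circ> ?k) z = (cnj \<circ> p \<circ> f \<circ> inv_into U \<phi>) z"
      using chart_inv_into[OF at U] chart_inv_into[OF bt V(1)] by auto
  qed
  moreover have "conjugate_pullback A B f w (U, \<phi>) (\<phi> x) = cnj (w (V, \<psi>) (\<psi> (f x))) * deriv ?k (\<phi> x)"
    using U x c chart_inv_into[OF at U x(1)] by (simp add: conjugate_pullback_def)
  ultimately show "(cnj \<circ> p \<circ> f \<circ> inv_into U \<phi> has_field_derivative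
      conjugate_pullback A B f w (U, \<phi>) (\<phi> x)) (at (\<phi> x))"
    by simp
qed

lemma holomorphic_differential_conjugate_pullback:
  assumes at: "complex_atlas X A" and bt: "complex_atlas Y B"
    and anti: "antiholomorphic_map X A Y B f" and w: "holomorphic_differential B w"
  shows "holomorphic_differential A (conjugate_pullback A B f w)"
proof (rule holomorphic_differential_if_local_primitives[OF at])
  fix x assume x: "x \<in> topspace X"
  have cont: "continuous_map X Y f"
    using anti by (simp add: antiholomorphic_map_def)
  then have "f x \<in> topspace Y"
    using x continuous_map_image_subset_topspace by fastforce
  then obtain W p where "openin Y W" "f x \<in> W" "local_primitive B w W p"
    using local_primitive_exists[OF bt w] by blast
  then show "\<exists>W p. openin X W \<and> x \<in> W \<and> local_primitive A (conjugate_pullback A B f w) W p"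
    using local_primitive_conjugate_pullback[OF at bt anti] x
      openin_continuous_map_preimage[OF cont, of W] by blast
qed (auto simp: conjugate_pullback_def)

section \<open>Primitives over parameter spaces and path integrals\<close>

text \<open>Arbitrary parameter spaces replace the interval of \<open>primitive_along\<close>, so
  that one notion serves paths and squares. Neighbourhoods are relative to \<open>S\<close> because
  edges and corners belong to the domain.\<close>

definition primitive_over ::
  "'a topology \<Rightarrow> 'a chart set \<Rightarrow> 'a differential \<Rightarrow> 'p::topological_space set \<Rightarrow>
     ('p \<Rightarrow> 'a) \<Rightarrow> ('p \<Rightarrow> complex) \<Rightarrow> bool" where
  "primitive_over X A w S q G \<longleftrightarrow>
     (\<forall>u\<in>S. \<exists>W f N. openin X W \<and> openin (top_of_set S) N \<and> u \<in> N \<and> q ` N \<subseteq> W \<and>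
        local_primitive A w W f \<and> (\<forall>v\<in>N. G v = f (q v)))"

lemma primitive_overE:
  assumes "primitive_over X A w S q G" "u \<in> S"
  obtains W N f where "openin X W" "openin (top_of_set S) N" "u \<in> N" "q ` N \<subseteq> W"
    "local_primitive A w W f" "\<forall>v\<in>N. G v = f (q v)"
  using assms unfolding primitive_over_def by (metis (no_types, lifting))

lemma primitive_along_iff_primitive_over:
  "primitive_along X A w \<gamma> F \<longleftrightarrow> primitive_over X A w {0..1} \<gamma> F"
proof
  assume L: "primitive_along X A w \<gamma> F"
  show "primitive_over X A w {0..1} \<gamma> F"
    unfolding primitive_over_def
  proof
    fix u :: real assume "u \<in> {0..1}"
    then obtain W f e where W: "openin X W" "local_primitive A w W f" "e > 0"
      "\<forall>v\<in>{0..1}. \<bar>v - u\<bar> < e \<longrightarrow> \<gamma> v \<in> W \<and> F v = f (\<gamma> v)"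
      using L unfolding primitive_along_def by blast
    moreover have "openin (top_of_set {0..1}) ({0..1} \<inter> ball u e)"
      by (simp add: openin_open_Int)
    moreover have "u \<in> {0..1} \<inter> ball u e" using W \<open>u \<in> {0..1}\<close> by simp
    moreover have "\<bar>v - u\<bar> < e" if "v \<in> ball u e" for v
      using that by (simp add: dist_real_def abs_minus_commute)
    ultimately show "\<exists>W f N. openin X W \<and> openin (top_of_set {0..1}) N \<and> u \<in> N \<and> \<gamma> ` N \<subseteq> W \<and>
        local_primitive A w W f \<and> (\<forall>v\<in>N. F v = f (\<gamma> v))"
      by (intro exI[of _ W] exI[of _ f] exI[of _ "{0..1} \<inter> ball u e"]) auto
  qed
next
  assume R: "primitive_over X A w {0..1} \<gamma> F"
  show "primitive_along X A w \<gamma> F"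
    unfolding primitive_along_def
  proof
    fix u :: real assume u: "u \<in> {0..1}"
    obtain W N f where W: "openin X W" "openin (top_of_set {0..1}) N" "u \<in> N" "\<gamma> ` N \<subseteq> W"
      "local_primitive A w W f" "\<forall>v\<in>N. F v = f (\<gamma> v)"
      using primitive_overE[OF R u] .
    obtain e where e: "e > 0" "ball u e \<inter> {0..1} \<subseteq> N"
      using W(2,3) by (meson openin_contains_ball)
    have "v \<in> N" if "v \<in> {0..1}" "\<bar>v - u\<bar> < e" for v
      using that e(2) by (auto simp: dist_real_def abs_minus_commute)
    with W have "\<exists>e>0. \<forall>v\<in>{0..1}. \<bar>v - u\<bar> < e \<longrightarrow> \<gamma> v \<in> W \<and> F v = f (\<gamma> v)"
      using e(1) by blast
    moreover have "\<gamma> u \<in> W" using W(3,4) by blast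
    ultimately show "\<exists>W f. openin X W \<and> \<gamma> u \<in> W \<and> local_primitive A w W f \<and>
        (\<exists>e>0. \<forall>v\<in>{0..1}. \<bar>v - u\<bar> < e \<longrightarrow> \<gamma> v \<in> W \<and> F v = f (\<gamma> v))"
      using W(1,5) by blast
  qed
qed

text \<open>The preimage of a neighbourhood under \<open>k\<close> works with the same local
  primitive. In this way a primitive over a square induces primitives along the paths inside
  it.\<close>

lemma primitive_over_compose:
  assumes G: "primitive_over X A w S q G" and k: "continuous_on T k" "k ` T \<subseteq> S"
  shows "primitive_over X A w T (q \<circ> k) (G \<circ> k)"
  unfolding primitive_over_def
proof
  fix u assume u: "u \<in> T"
  then have ku: "k u \<in> S" using k(2) by blast
  obtain W N f where W: "openin X W" "openin (top_of_set S) N" "k u \<in> N" "q ` N \<subseteq> W"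
      "local_primitive A w W f" "\<forall>v\<in>N. G v = f (q v)"
    using primitive_overE[OF G ku] .
  have "openin (top_of_set T) (T \<inter> k -` N)"
    using continuous_openin_preimage[OF k(1) _ W(2)] k(2) by blast
  then show "\<exists>W f N. openin X W \<and> openin (top_of_set T) N \<and> u \<in> N \<and> (q \<circ> k) ` N \<subseteq> W \<and>
        local_primitive A w W f \<and> (\<forall>v\<in>N. (G \<circ> k) v = f ((q \<circ> k) v))"
    using W u by (intro exI[of _ W] exI[of _ f] exI[of _ "T \<inter> k -` N"]) auto
qed

lemma primitive_over_subset:
  "primitive_over X A w S q G \<Longrightarrow> T \<subseteq> S \<Longrightarrow> primitive_over X A w T q G"
  using primitive_over_compose[of X A w S q G T "\<lambda>x. x"] by (simp add: o_def)

lemma primitive_over_cong: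
  assumes "primitive_over X A w S q G" "\<And>u. u \<in> S \<Longrightarrow> q u = q' u" "\<And>u. u \<in> S \<Longrightarrow> G u = G' u"
  shows "primitive_over X A w S q' G'"
  unfolding primitive_over_def
proof
  fix u assume u: "u \<in> S"
  obtain W N f where W: "openin X W" "openin (top_of_set S) N" "u \<in> N" "q ` N \<subseteq> W"
      "local_primitive A w W f" "\<forall>v\<in>N. G v = f (q v)"
    using primitive_overE[OF assms(1) u] .
  moreover have "N \<subseteq> S" using W(2) openin_imp_subset by blast
  ultimately show "\<exists>W f N. openin X W \<and> openin (top_of_set S) N \<and> u \<in> N \<and> q' ` N \<subseteq> W \<and>
        local_primitive A w W f \<and> (\<forall>v\<in>N. G' v = f (q' v))"
    using assms(2,3) by (intro exI[of _ W] exI[of _ f] exI[of _ N]) (auto simp: subset_iff image_iff)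
qed

lemma primitive_over_shift:
  assumes "primitive_over X A w S q G"
  shows "primitive_over X A w S q (\<lambda>v. G v + c)"
  unfolding primitive_over_def
proof
  fix u assume u: "u \<in> S"
  obtain W N f where W: "openin X W" "openin (top_of_set S) N" "u \<in> N" "q ` N \<subseteq> W"
      "local_primitive A w W f" "\<forall>v\<in>N. G v = f (q v)"
    using primitive_overE[OF assms(1) u] .
  then show "\<exists>W f N. openin X W \<and> openin (top_of_set S) N \<and> u \<in> N \<and> q ` N \<subseteq> W \<and>
        local_primitive A w W f \<and> (\<forall>v\<in>N. G v + c = f (q v))"
    using local_primitive_shift[OF W(5), of c]
    by (intro exI[of _ W] exI[of _ "\<lambda>x. f x + c"] exI[of _ N]) auto
qed

lemma primitive_over_scale:
  assumes "primitive_over X A w S q G"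
  shows "primitive_over X A (scale_differential c w) S q (\<lambda>v. c * G v)"
  unfolding primitive_over_def
proof
  fix u assume u: "u \<in> S"
  obtain W N f where W: "openin X W" "openin (top_of_set S) N" "u \<in> N" "q ` N \<subseteq> W"
      "local_primitive A w W f" "\<forall>v\<in>N. G v = f (q v)"
    using primitive_overE[OF assms(1) u] .
  then show "\<exists>W f N. openin X W \<and> openin (top_of_set S) N \<and> u \<in> N \<and> q ` N \<subseteq> W \<and>
        local_primitive A (scale_differential c w) W f \<and> (\<forall>v\<in>N. c * G v = f (q v))"
    using local_primitive_scale[OF W(5), of c]
    by (intro exI[of _ W] exI[of _ "\<lambda>x. c * f x"] exI[of _ N]) auto
qed

lemma primitive_over_add:
  assumes "primitive_over X A w S q G" "primitive_over X A w' S q G'"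
  shows "primitive_over X A (w + w') S q (\<lambda>v. G v + G' v)"
  unfolding primitive_over_def
proof
  fix u assume u: "u \<in> S"
  obtain W N f where W: "openin X W" "openin (top_of_set S) N" "u \<in> N" "q ` N \<subseteq> W"
      "local_primitive A w W f" "\<forall>v\<in>N. G v = f (q v)"
    using primitive_overE[OF assms(1) u] .
  obtain W' N' f' where W': "openin X W'" "openin (top_of_set S) N'" "u \<in> N'" "q ` N' \<subseteq> W'"
      "local_primitive A w' W' f'" "\<forall>v\<in>N'. G' v = f' (q v)"
    using primitive_overE[OF assms(2) u] .
  have "local_primitive A (w + w') (W \<inter> W') (\<lambda>x. f x + f' x)"
    by (intro local_primitive_add local_primitive_subset[OF W(5)] local_primitive_subset[OF W'(5)]) auto
  then show "\<exists>W f N. openin X W \<and> openin (top_of_set S) N \<and> u \<in> N \<and> q ` N \<subseteq> W \<and>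
        local_primitive A (w + w') W f \<and> (\<forall>v\<in>N. G v + G' v = f (q v))"
    using W W' openin_Int[OF W(1) W'(1)] openin_Int[OF W(2) W'(2)]
    by (intro exI[of _ "W \<inter> W'"] exI[of _ "\<lambda>x. f x + f' x"] exI[of _ "N \<inter> N'"]) auto
qed

lemma primitive_over_conjugate_pullback:
  assumes at: "complex_atlas X A" and bt: "complex_atlas Y B"
    and anti: "antiholomorphic_map X A Y B f"
    and q: "q ` S \<subseteq> topspace X"
    and G: "primitive_over Y B w S (f \<circ> q) G"
  shows "primitive_over X A (conjugate_pullback A B f w) S q (cnj \<circ> G)"
  unfolding primitive_over_def
proof
  fix u assume u: "u \<in> S"
  obtain W N p where W: "openin Y W" "openin (top_of_set S) N" "u \<in> N" "(f \<circ> q) ` N \<subseteq> W"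
      "local_primitive B w W p" "\<forall>v\<in>N. G v = p ((f \<circ> q) v)"
    using primitive_overE[OF G u] .
  have cont: "continuous_map X Y f"
    using anti by (simp add: antiholomorphic_map_def)
  have "openin X {x \<in> topspace X. f x \<in> W}"
    using openin_continuous_map_preimage[OF cont W(1)] .
  moreover have "q ` N \<subseteq> topspace X" using q W(2) openin_imp_subset by blast
  moreover note local_primitive_conjugate_pullback[OF at bt anti W(1,5)]
  ultimately show "\<exists>W p N. openin X W \<and> openin (top_of_set S) N \<and> u \<in> N \<and> q ` N \<subseteq> W \<and>
        local_primitive A (conjugate_pullback A B f w) W p \<and> (\<forall>v\<in>N. (cnj \<circ> G) v = p (q v))"
    using W by (intro exI[of _ "{x \<in> topspace X. f x \<in> W}"] exI[of _ "cnj \<circ> p \<circ> f"] exI[of _ N]) auto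
qed

text \<open>Near \<open>q u\<close> two local primitives of the same differential differ by a
  constant, so the difference of \<open>G\<close> and \<open>H\<close> is locally constant on the
  connected set \<open>S\<close>.\<close>

lemma primitive_over_diff_constant:
  fixes q :: "'p::topological_space \<Rightarrow> 'a"
  assumes at: "complex_atlas X A" and q: "continuous_map (top_of_set S) X q" and S: "connected S"
    and G: "primitive_over X A w S q G" and H: "primitive_over X A w S q H"
    and uv: "u \<in> S" "v \<in> S"
  shows "G u - H u = G v - H v"
proof -
  have "(\<lambda>v. G v - H v) constant_on S"
  proof (rule locally_constant_imp_constant[OF S])
    fix u assume u: "u \<in> S"
    obtain W N f where W: "openin X W" "openin (top_of_set S) N" "u \<in> N" "q ` N \<subseteq> W"
        "local_primitive A w W f" "\<forall>v\<in>N. G v = f (q v)"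
      using primitive_overE[OF G u] .
    obtain W' N' f' where W': "openin X W'" "openin (top_of_set S) N'" "u \<in> N'" "q ` N' \<subseteq> W'"
        "local_primitive A w W' f'" "\<forall>v\<in>N'. H v = f' (q v)"
      using primitive_overE[OF H u] .
    define c where "c = f (q u) - f' (q u)"
    have qu: "q u \<in> W" "q u \<in> W'" "f (q u) = f' (q u) + c"
      using W W' by (auto simp: c_def)
    obtain V where V: "openin X V" "q u \<in> V" "V \<subseteq> W \<inter> W'" "\<forall>y\<in>V. f y = f' y + c"
      by (rule local_primitive_agree[OF at W(1) W'(1) qu(1,2) W(5) local_primitive_shift[OF W'(5)] qu(3)])
    have "openin (top_of_set S) {v \<in> topspace (top_of_set S). q v \<in> V}"
      using openin_continuous_map_preimage[OF q V(1)] .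
    then have "openin (top_of_set S) (N \<inter> N' \<inter> {v \<in> S. q v \<in> V})"
      using W W' by auto
    then show "\<exists>T. openin (top_of_set S) T \<and> u \<in> T \<and> (\<forall>x\<in>T. G x - H x = G u - H u)"
      using W(3,6) W'(3,6) V u by (intro exI[of _ "N \<inter> N' \<inter> {v \<in> S. q v \<in> V}"]) auto
  qed
  then show ?thesis
    using uv unfolding constant_on_def by metis
qed

text \<open>At a common point the two local primitives have the same value at \<open>q u\<close>,
  hence agree near it, and one of them serves both sides. At a point of only one set, closedness of
  the other set provides a neighbourhood avoiding it.\<close>

lemma primitive_over_Un:
  fixes q :: "'p::topological_space \<Rightarrow> 'a"
  assumes at: "complex_atlas X A" and q: "continuous_map (top_of_set (S \<union> T)) X q"
    and cl: "closed S" "closed T"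
    and G: "primitive_over X A w S q G" and H: "primitive_over X A w T q H"
    and eq: "\<And>u. u \<in> S \<Longrightarrow> u \<in> T \<Longrightarrow> G u = H u"
  shows "primitive_over X A w (S \<union> T) q (\<lambda>v. if v \<in> S then G v else H v)"
  unfolding primitive_over_def
proof
  fix u assume u: "u \<in> S \<union> T"
  let ?F = "\<lambda>v. if v \<in> S then G v else H v"
  consider "u \<in> S" "u \<in> T" | "u \<in> S" "u \<notin> T" | "u \<notin> S" "u \<in> T" using u by blast
  then show "\<exists>W f N. openin X W \<and> openin (top_of_set (S \<union> T)) N \<and> u \<in> N \<and> q ` N \<subseteq> W \<and>
        local_primitive A w W f \<and> (\<forall>v\<in>N. ?F v = f (q v))"
  proof cases
    case 1
    obtain W N f where W: "openin X W" "openin (top_of_set S) N" "u \<in> N" "q ` N \<subseteq> W"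
        "local_primitive A w W f" "\<forall>v\<in>N. G v = f (q v)"
      using primitive_overE[OF G 1(1)] .
    obtain W' N' f' where W': "openin X W'" "openin (top_of_set T) N'" "u \<in> N'" "q ` N' \<subseteq> W'"
        "local_primitive A w W' f'" "\<forall>v\<in>N'. H v = f' (q v)"
      using primitive_overE[OF H 1(2)] .
    have qu: "q u \<in> W" "q u \<in> W'" "f (q u) = f' (q u)"
      using W(3,4) W'(3,4) bspec[OF W(6) W(3)] bspec[OF W'(6) W'(3)] eq[OF 1] by auto
    obtain V where V: "openin X V" "q u \<in> V" "V \<subseteq> W \<inter> W'" "\<forall>y\<in>V. f y = f' y"
      by (rule local_primitive_agree[OF at W(1) W'(1) qu(1,2) W(5) W'(5) qu(3)])
    obtain P P' where P: "open P" "N = S \<inter> P" "open P'" "N' = T \<inter> P'"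
      using W(2) W'(2) by (auto simp: openin_open)
    have "openin (top_of_set (S \<union> T)) {v \<in> topspace (top_of_set (S \<union> T)). q v \<in> V}"
      using openin_continuous_map_preimage[OF q V(1)] .
    moreover have "openin (top_of_set (S \<union> T)) ((S \<union> T) \<inter> (P \<inter> P'))"
      using P by (intro openin_open_Int) auto
    ultimately have "openin (top_of_set (S \<union> T)) ((S \<union> T) \<inter> (P \<inter> P') \<inter> {v \<in> S \<union> T. q v \<in> V})"
      by auto
    then show ?thesis
      using V(1,2,4) W(3,6) W'(3,6) P u local_primitive_subset[OF W(5)] V(3)
      by (intro exI[of _ V] exI[of _ f] exI[of _ "(S \<union> T) \<inter> (P \<inter> P') \<inter> {v \<in> S \<union> T. q v \<in> V}"]) auto
  next
    case 2
    obtain W N f where W: "openin X W" "openin (top_of_set S) N" "u \<in> N" "q ` N \<subseteq> W"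
        "local_primitive A w W f" "\<forall>v\<in>N. G v = f (q v)"
      using primitive_overE[OF G 2(1)] .
    obtain P where P: "open P" "N = S \<inter> P"
      using W(2) by (auto simp: openin_open)
    have "openin (top_of_set (S \<union> T)) ((S \<union> T) \<inter> (P - T))"
      using P cl by (intro openin_open_Int open_Diff) auto
    then show ?thesis
      using 2 W P by (intro exI[of _ W] exI[of _ f] exI[of _ "(S \<union> T) \<inter> (P - T)"]) auto
  next
    case 3
    obtain W N f where W: "openin X W" "openin (top_of_set T) N" "u \<in> N" "q ` N \<subseteq> W"
        "local_primitive A w W f" "\<forall>v\<in>N. H v = f (q v)"
      using primitive_overE[OF H 3(2)] .
    obtain P where P: "open P" "N = T \<inter> P"
      using W(2) by (auto simp: openin_open)
    have "openin (top_of_set (S \<union> T)) ((S \<union> T) \<inter> (P - S))"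
      using P cl by (intro openin_open_Int open_Diff) auto
    then show ?thesis
      using 3 W P by (intro exI[of _ W] exI[of _ f] exI[of _ "(S \<union> T) \<inter> (P - S)"]) auto
  qed
qed

text \<open>On the connected intersection the two primitives differ by a single constant; shifting
  one of them by it makes them match. An empty intersection imposes no condition.\<close>

lemma primitive_over_Un_exists:
  fixes q :: "'p::topological_space \<Rightarrow> 'a"
  assumes at: "complex_atlas X A" and q: "continuous_map (top_of_set (S \<union> T)) X q"
    and cl: "closed S" "closed T" and con: "connected (S \<inter> T)"
    and G: "primitive_over X A w S q G" and H: "primitive_over X A w T q H"
  shows "\<exists>F. primitive_over X A w (S \<union> T) q F"
proof -
  have "\<exists>c. \<forall>u\<in>S \<inter> T. G u = H u + c"
  proof (cases "S \<inter> T = {}")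
    case False
    then obtain v where v: "v \<in> S \<inter> T" by blast
    have "continuous_map (top_of_set (S \<inter> T)) X q"
      by (rule continuous_map_from_subtopology_mono[OF q]) auto
    then have "G u - H u = G v - H v" if "u \<in> S \<inter> T" for u
      using primitive_over_diff_constant[OF at _ con primitive_over_subset[OF G]
          primitive_over_subset[OF H] that v] by blast
    then show ?thesis
      by (intro exI[of _ "G v - H v"]) (simp add: algebra_simps)
  qed auto
  then obtain c where "\<And>u. u \<in> S \<Longrightarrow> u \<in> T \<Longrightarrow> G u = H u + c" by blast
  then show ?thesis
    using primitive_over_Un[OF at q cl G primitive_over_shift[OF H]] by blast
qed

text \<open>Bisection in each of the two coordinates: the existence of a primitive over a rectangle is
  local, and primitives over two rectangles glue because the common part is connected.\<close>

lemma primitive_over_square_exists: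
  fixes q :: "real \<times> real \<Rightarrow> 'a"
  assumes at: "complex_atlas X A" and w: "holomorphic_differential A w"
    and q: "continuous_map (top_of_set ({0..1} \<times> {0..1})) X q"
  shows "\<exists>G. primitive_over X A w ({0..1} \<times> {0..1}) q G"
proof -
  define Q :: "(real \<times> real) set" where "Q = {0..1} \<times> {0..1}"
  \<comment> \<open>Intersecting with \<open>Q\<close> allows rectangles to spill over the square or
    to be infinite strips, so the bisections meet no boundary cases.\<close>
  define P where "P S \<longleftrightarrow> (\<exists>G. primitive_over X A w (S \<inter> Q) q G)" for S
  have Q: "convex Q" "closed Q"
    unfolding Q_def by (auto intro: convex_Times closed_Times)
  have mono: "P T" if "P S" "T \<inter> Q \<subseteq> S" for S T
    using that primitive_over_subset[of X A w "S \<inter> Q" q] unfolding P_def by (metis Int_greatest Int_lower2)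
  have union: "P (S \<union> T)" if "P S" "P T" "closed S" "closed T" "convex S" "convex T" for S T
  proof -
    have *: "S \<inter> Q \<union> T \<inter> Q = (S \<union> T) \<inter> Q" by blast
    have "continuous_map (top_of_set (S \<inter> Q \<union> T \<inter> Q)) X q"
      by (rule continuous_map_from_subtopology_mono[OF q]) (auto simp: Q_def)
    moreover have "connected ((S \<inter> Q) \<inter> (T \<inter> Q))"
      using that Q by (intro convex_connected convex_Int) auto
    ultimately show ?thesis
      using that(1,2) primitive_over_Un_exists[OF at, of "S \<inter> Q" "T \<inter> Q" q w]
        closed_Int[OF that(3) Q(2)] closed_Int[OF that(4) Q(2)]
      unfolding P_def * by blast
  qed
  have "P ({0..1} \<times> UNIV)"
  proof (rule Bolzano[where P = "\<lambda>a b. P ({a..b} \<times> UNIV)"])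
    fix a b c :: real
    assume "P ({a..b} \<times> UNIV)" "P ({b..c} \<times> UNIV)" "a \<le> b" "b \<le> c"
    then have "P ({a..b} \<times> UNIV \<union> {b..c} \<times> UNIV)"
      by (intro union closed_Times convex_Times) auto
    moreover have "{a..c} \<times> UNIV = {a..b} \<times> UNIV \<union> {b..c} \<times> (UNIV :: real set)"
      using \<open>a \<le> b\<close> \<open>b \<le> c\<close> by auto
    ultimately show "P ({a..c} \<times> UNIV)" by simp
  next
    fix x :: real assume x: "0 \<le> x" "x \<le> 1"
    \<comment> \<open>The half-width \<open>e\<close> may depend on the vertical interval. Joining
      two intervals keeps the smaller value, so bisection delivers one width for the whole vertical
      segment above \<open>x\<close>.\<close>
    have "\<exists>e>0. P ({x - e..x + e} \<times> {0..1})"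
    proof (rule Bolzano[where P = "\<lambda>a b. \<exists>e>0. P ({x - e..x + e} \<times> {a..b})"])
      fix a b c :: real
      assume 1: "\<exists>e>0. P ({x - e..x + e} \<times> {a..b})" "\<exists>e>0. P ({x - e..x + e} \<times> {b..c})" "a \<le> b" "b \<le> c"
      then obtain e e' where e: "e > 0" "P ({x - e..x + e} \<times> {a..b})"
        "e' > 0" "P ({x - e'..x + e'} \<times> {b..c})" by blast
      define d where "d = min e e'"
      have "P ({x - d..x + d} \<times> {a..b})" "P ({x - d..x + d} \<times> {b..c})"
        by (rule mono[OF e(2)], force simp: d_def, rule mono[OF e(4)], force simp: d_def)
      then have "P ({x - d..x + d} \<times> {a..b} \<union> {x - d..x + d} \<times> {b..c})"
        by (intro union closed_Times convex_Times) auto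
      moreover have "{x - d..x + d} \<times> {a..c} = {x - d..x + d} \<times> {a..b} \<union> {x - d..x + d} \<times> {b..c}"
        using \<open>a \<le> b\<close> \<open>b \<le> c\<close> by auto
      moreover have "d > 0" using e by (simp add: d_def)
      ultimately show "\<exists>e>0. P ({x - e..x + e} \<times> {a..c})" by auto
    next
      fix y :: real assume y: "0 \<le> y" "y \<le> 1"
      have xy: "(x, y) \<in> Q" using x y by (simp add: Q_def)
      then have "q (x, y) \<in> topspace X"
        using continuous_map_image_subset_topspace[OF q] unfolding Q_def by fastforce
      then obtain W f where W: "openin X W" "q (x, y) \<in> W" "local_primitive A w W f"
        using local_primitive_exists[OF at w] by blast
      have "openin (top_of_set Q) {p \<in> topspace (top_of_set Q). q p \<in> W}"
        using openin_continuous_map_preimage[OF q W(1)] unfolding Q_def .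
      moreover have "(x, y) \<in> {p \<in> topspace (top_of_set Q). q p \<in> W}"
        using W(2) xy by simp
      ultimately obtain r where r: "r > 0" "ball (x, y) r \<inter> Q \<subseteq> {p \<in> topspace (top_of_set Q). q p \<in> W}"
        by (meson openin_contains_ball)
      \<comment> \<open>Two deviations of at most \<open>r / 2\<close>, the vertical one strictly
        smaller, add up to less than \<open>r\<close>, which bounds the Euclidean distance from
        \<open>(x, y)\<close>.\<close>
      have "P ({x - r / 2..x + r / 2} \<times> {a..b})" if ab: "a \<le> y" "y \<le> b" "b - a < r / 2" for a b
      proof -
        let ?S = "{x - r / 2..x + r / 2} \<times> {a..b}"
        have "?S \<subseteq> ball (x, y) r"
        proof
          fix p assume p: "p \<in> ?S"
          obtain u v where uv: "p = (u, v)" by force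
          have "dist (x, y) p \<le> \<bar>x - u\<bar> + \<bar>y - v\<bar>"
            unfolding uv dist_Pair_Pair dist_real_def
            using sqrt_sum_squares_le_sum_abs[of "x - u" "y - v"] by simp
          also have "\<dots> < r"
            using p ab unfolding uv by (auto simp: abs_real_def)
          finally show "p \<in> ball (x, y) r" by simp
        qed
        then have "q ` (?S \<inter> Q) \<subseteq> W"
          using r(2) by blast
        then have "primitive_over X A w (?S \<inter> Q) q (\<lambda>p. f (q p))"
          unfolding primitive_over_def using W by blast
        then show ?thesis
          unfolding P_def by blast
      qed
      then show "\<exists>d>0. \<forall>a b. a \<le> y \<and> y \<le> b \<and> b - a < d \<longrightarrow>
          (\<exists>e>0. P ({x - e..x + e} \<times> {a..b}))"
        using r(1) half_gt_zero by blast
    qed auto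
    then obtain e where e: "e > 0" "P ({x - e..x + e} \<times> {0..1})" by blast
    have "P ({a..b} \<times> UNIV)" if "a \<le> x" "x \<le> b" "b - a < e" for a b
      by (rule mono[OF e(2)]) (use that in \<open>auto simp: Q_def\<close>)
    then show "\<exists>d>0. \<forall>a b. a \<le> x \<and> x \<le> b \<and> b - a < d \<longrightarrow> P ({a..b} \<times> UNIV)"
      using e(1) by blast
  qed auto
  moreover have "{0..1} \<times> UNIV \<inter> Q = Q" by (auto simp: Q_def)
  ultimately show ?thesis
    unfolding P_def Q_def by simp
qed

text \<open>A path becomes a map of the square that ignores the second coordinate; restricting a
  primitive over the square to the bottom edge returns to the path.\<close>

lemma primitive_over_path_exists:
  fixes \<gamma> :: "real \<Rightarrow> 'a"
  assumes at: "complex_atlas X A" and w: "holomorphic_differential A w"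
    and \<gamma>: "continuous_map (top_of_set {0..1}) X \<gamma>"
  obtains F where "primitive_over X A w {0..1} \<gamma> F"
proof -
  let ?Q = "{0..1} \<times> {0..1} :: (real \<times> real) set"
  have "continuous_map (top_of_set ?Q) (top_of_set {0..1}) fst"
    by (auto intro: continuous_intros)
  then have "continuous_map (top_of_set ?Q) X (\<gamma> \<circ> fst)"
    using \<gamma> by (rule continuous_map_compose)
  then obtain G where "primitive_over X A w ?Q (\<gamma> \<circ> fst) G"
    using primitive_over_square_exists[OF at w] by blast
  moreover have "continuous_on {0..1} (\<lambda>u::real. (u, 0::real))"
    by (intro continuous_intros)
  moreover have "(\<lambda>u. (u, 0)) ` {0..1} \<subseteq> ?Q" by auto
  ultimately have "primitive_over X A w {0..1} (\<gamma> \<circ> fst \<circ> (\<lambda>u. (u, 0 :: real))) (G \<circ> (\<lambda>u. (u, 0)))"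
    by (rule primitive_over_compose)
  then show ?thesis
    using that by (simp add: o_def)
qed

text \<open>Two primitives along the path differ by a constant, so their increments coincide and the
  definite description in \<open>path_integral\<close> has a unique solution.\<close>

lemma path_integral_eq:
  assumes at: "complex_atlas X A" and \<gamma>: "continuous_map (top_of_set {0..1}) X \<gamma>"
    and F: "primitive_over X A w {0..1} \<gamma> F"
  shows "path_integral X A w \<gamma> = F 1 - F 0"
  unfolding path_integral_def primitive_along_iff_primitive_over
proof (rule the_equality)
  show "\<exists>F'. primitive_over X A w {0..1} \<gamma> F' \<and> F 1 - F 0 = F' 1 - F' 0"
    using F by blast
  fix I assume "\<exists>F. primitive_over X A w {0..1} \<gamma> F \<and> I = F 1 - F 0"
  then obtain H where H: "primitive_over X A w {0..1} \<gamma> H" "I = H 1 - H 0" by blast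
  have "F 1 - H 1 = F 0 - H 0"
    by (rule primitive_over_diff_constant[OF at \<gamma> _ F H(1)]) auto
  moreover have "F 1 - F 0 = (F 1 - H 1) - (F 0 - H 0) + (H 1 - H 0)"
    by simp
  ultimately show "I = F 1 - F 0"
    using H(2) by simp
qed

text \<open>Faces and images of singular simplices are restricted to the standard simplex, so their
  paths have the expected values only for parameters in the unit interval; this must not affect the
  integral.\<close>

lemma path_integral_cong:
  assumes "\<And>u. u \<in> {0..1} \<Longrightarrow> \<gamma> u = \<delta> u"
  shows "path_integral X A w \<gamma> = path_integral X A w \<delta>"
proof -
  have "primitive_over X A w {0..1} \<gamma> F \<longleftrightarrow> primitive_over X A w {0..1} \<delta> F" for F
    using primitive_over_cong assms by metis
  then show ?thesis
    unfolding path_integral_def primitive_along_iff_primitive_over by simp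
qed

lemma path_integral_add:
  assumes at: "complex_atlas X A" and \<gamma>: "continuous_map (top_of_set {0..1}) X \<gamma>"
    and w: "holomorphic_differential A w" "holomorphic_differential A w'"
  shows "path_integral X A (w + w') \<gamma> = path_integral X A w \<gamma> + path_integral X A w' \<gamma>"
proof -
  obtain F where F: "primitive_over X A w {0..1} \<gamma> F"
    using primitive_over_path_exists[OF at w(1) \<gamma>] .
  obtain F' where F': "primitive_over X A w' {0..1} \<gamma> F'"
    using primitive_over_path_exists[OF at w(2) \<gamma>] .
  show ?thesis
    unfolding path_integral_eq[OF at \<gamma> F] path_integral_eq[OF at \<gamma> F']
      path_integral_eq[OF at \<gamma> primitive_over_add[OF F F']] by simp
qed

lemma path_integral_scale:
  assumes at: "complex_atlas X A" and \<gamma>: "continuous_map (top_of_set {0..1}) X \<gamma>"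
    and w: "holomorphic_differential A w"
  shows "path_integral X A (scale_differential c w) \<gamma> = c * path_integral X A w \<gamma>"
proof -
  obtain F where F: "primitive_over X A w {0..1} \<gamma> F"
    using primitive_over_path_exists[OF at w(1) \<gamma>] .
  show ?thesis
    unfolding path_integral_eq[OF at \<gamma> F] path_integral_eq[OF at \<gamma> primitive_over_scale[OF F]]
    by (simp add: algebra_simps)
qed

lemma path_integral_conjugate_pullback:
  assumes at: "complex_atlas X A" and bt: "complex_atlas Y B"
    and anti: "antiholomorphic_map X A Y B f" and w: "holomorphic_differential B w"
    and \<gamma>: "continuous_map (top_of_set {0..1}) X \<gamma>"
  shows "path_integral X A (conjugate_pullback A B f w) \<gamma> = cnj (path_integral Y B w (f \<circ> \<gamma>))"
proof -
  have "continuous_map X Y f"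
    using anti by (simp add: antiholomorphic_map_def)
  with \<gamma> have cont: "continuous_map (top_of_set {0..1}) Y (f \<circ> \<gamma>)"
    by (rule continuous_map_compose)
  obtain F where F: "primitive_over Y B w {0..1} (f \<circ> \<gamma>) F"
    using primitive_over_path_exists[OF bt w cont] .
  have "\<gamma> ` {0..1} \<subseteq> topspace X"
    using continuous_map_image_subset_topspace[OF \<gamma>] by simp
  from primitive_over_conjugate_pullback[OF at bt anti this F] show ?thesis
    using path_integral_eq[OF at \<gamma>] path_integral_eq[OF bt cont F] by simp
qed

section \<open>Periods and homology\<close>

lemma period_eq_sum:
  assumes "finite S" "Poly_Mapping.keys c \<subseteq> S"
  shows "period X A c w =
    (\<Sum>f\<in>S. of_int (Poly_Mapping.lookup c f) * path_integral X A w (simplex_path f))"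
  unfolding period_def
  by (rule sum.mono_neutral_left[OF assms]) (simp add: in_keys_iff)

lemma period_zero [simp]: "period X A 0 w = 0"
  by (simp add: period_def)

lemma period_frag_of [simp]: "period X A (frag_of f) w = path_integral X A w (simplex_path f)"
  by (simp add: period_def)

lemma period_add: "period X A (c + d) w = period X A c w + period X A d w"
proof -
  let ?S = "Poly_Mapping.keys c \<union> Poly_Mapping.keys d"
  have "Poly_Mapping.keys (c + d) \<subseteq> ?S" by (rule Poly_Mapping.keys_add)
  then show ?thesis
    using period_eq_sum[of ?S "c + d" X A w] period_eq_sum[of ?S c X A w] period_eq_sum[of ?S d X A w]
    by (simp add: lookup_add distrib_right sum.distrib)
qed

lemma period_minus: "period X A (- c) w = - period X A c w"
  using period_add[of X A c "- c" w] by (simp add: eq_neg_iff_add_eq_0 add.commute)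

lemma period_diff: "period X A (c - d) w = period X A c w - period X A d w"
  using period_add[of X A c "- d" w] by (simp add: period_minus)

lemma standard_simplex_segment:
  "u \<in> {0..1} \<Longrightarrow> (\<lambda>i. if i = 0 then 1 - u else if i = 1 then u else 0) \<in> standard_simplex 1"
  by (auto simp: standard_simplex_def)

lemma continuous_map_simplex_path:
  assumes "singular_simplex 1 X f"
  shows "continuous_map (top_of_set {0..1}) X (simplex_path f)"
proof -
  let ?e = "\<lambda>(u::real) (i::nat). if i = 0 then 1 - u else if i = 1 then u else 0"
  have "continuous_map (top_of_set {0..1}) (powertop_real UNIV) ?e"
    unfolding continuous_map_componentwise_UNIV
  proof
    fix i :: nat
    show "continuous_map (top_of_set {0..1}) euclideanreal (\<lambda>u. ?e u i)"
      by (cases "i = 0"; cases "i = 1") (auto intro!: continuous_intros)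
  qed
  moreover have "?e ` {0..1} \<subseteq> standard_simplex 1"
    using standard_simplex_segment by blast
  ultimately have "continuous_map (top_of_set {0..1})
      (subtopology (powertop_real UNIV) (standard_simplex 1)) ?e"
    by (auto simp: continuous_map_in_subtopology)
  then have "continuous_map (top_of_set {0..1}) X (f \<circ> ?e)"
    using assms continuous_map_compose unfolding singular_simplex_def by blast
  moreover have "f \<circ> ?e = simplex_path f"
    by (simp add: fun_eq_iff simplex_path_def)
  ultimately show ?thesis by metis
qed

section \<open>Dependence of periods on the differential\<close>

lemma period_add_differential:
  assumes at: "complex_atlas X A" and c: "singular_chain 1 X c"
    and w: "holomorphic_differential A w" "holomorphic_differential A w'"
  shows "period X A c (w + w') = period X A c w + period X A c w'"
proof -
  have "path_integral X A (w + w') (simplex_path f) =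
      path_integral X A w (simplex_path f) + path_integral X A w' (simplex_path f)"
    if "f \<in> Poly_Mapping.keys c" for f
    using that c path_integral_add[OF at continuous_map_simplex_path w]
    unfolding singular_chain_def by blast
  then show ?thesis
    by (simp add: period_def distrib_left sum.distrib)
qed

lemma period_scale_differential:
  assumes at: "complex_atlas X A" and c: "singular_chain 1 X c"
    and w: "holomorphic_differential A w"
  shows "period X A c (scale_differential k w) = k * period X A c w"
proof -
  have "path_integral X A (scale_differential k w) (simplex_path f) =
      k * path_integral X A w (simplex_path f)"
    if "f \<in> Poly_Mapping.keys c" for f
    using that c path_integral_scale[OF at continuous_map_simplex_path w]
    unfolding singular_chain_def by blast
  then show ?thesis
    by (simp add: period_def sum_distrib_left mult.left_commute)
qed

text \<open>Both sides are additive in the chain, which leaves a single simplex; there the path of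
  the image simplex is the image of the path.\<close>

lemma period_conjugate_pullback:
  assumes at: "complex_atlas X A" and bt: "complex_atlas Y B"
    and anti: "antiholomorphic_map X A Y B f" and w: "holomorphic_differential B w"
    and c: "singular_chain 1 X c"
  shows "period X A c (conjugate_pullback A B f w) = cnj (period Y B (chain_map 1 f c) w)"
  using c unfolding singular_chain_def
proof (induction c rule: frag_induction)
  case (one k)
  then have k: "singular_simplex 1 X k" by simp
  have "path_integral Y B w (f \<circ> simplex_path k) = path_integral Y B w (simplex_path (simplex_map 1 f k))"
    by (rule path_integral_cong)
      (use standard_simplex_segment in \<open>simp add: simplex_path_def simplex_map_def\<close>)
  then show ?case
    using path_integral_conjugate_pullback[OF at bt anti w continuous_map_simplex_path[OF k]] by simp
qed (simp_all add: period_diff chain_map_diff)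

text \<open>The square is mapped onto the triangle by collapsing one edge to vertex 0, so that a
  primitive over the square has total increment 0 around the triangle.\<close>

lemma period_boundary_simplex:
  assumes at: "complex_atlas X A" and w: "holomorphic_differential A w"
    and f: "singular_simplex 2 X f"
  shows "period X A (chain_boundary 2 (frag_of f)) w = 0"
proof -
  let ?Q = "{0..1} \<times> {0..1} :: (real \<times> real) set"
  \<comment> \<open>The point \<open>(x, y)\<close> receives the barycentric coordinates
    \<open>1 - x\<close>, \<open>x * (1 - y)\<close>, \<open>x * y\<close>: the side
    \<open>x = 0\<close> shrinks to vertex 0 and the side \<open>x = 1\<close> becomes the opposite
    edge.\<close>
  define T where "T = (\<lambda>(p :: real \<times> real) (i::nat). if i = 0 then 1 - fst p else
    if i = 1 then fst p * (1 - snd p) else if i = 2 then fst p * snd p else 0)"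
  have T_simplex: "T p \<in> standard_simplex 2" if "p \<in> ?Q" for p
  proof -
    obtain x y where p: "p = (x, y)" by (rule prod.exhaust)
    with that have xy: "0 \<le> x" "x \<le> 1" "0 \<le> y" "y \<le> 1" by simp_all
    then have "x * y \<le> x" "x \<le> 1 + x * y"
      by (simp_all add: mult_left_le add_increasing2)
    then show ?thesis
      using p xy by (auto simp: T_def standard_simplex_def numeral_2_eq_2 algebra_simps)
  qed
  have "continuous_map (top_of_set ?Q) (powertop_real UNIV) T"
    unfolding continuous_map_componentwise_UNIV
  proof
    fix i :: nat
    show "continuous_map (top_of_set ?Q) euclideanreal (\<lambda>p. T p i)"
      unfolding T_def
      by (cases "i = 0"; cases "i = 1"; cases "i = 2") (auto intro!: continuous_intros)
  qed
  then have "continuous_map (top_of_set ?Q)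
      (subtopology (powertop_real UNIV) (standard_simplex 2)) T"
    using T_simplex by (auto simp: continuous_map_in_subtopology)
  moreover have "continuous_map (subtopology (powertop_real UNIV) (standard_simplex 2)) X f"
    using f by (simp add: singular_simplex_def)
  ultimately have q: "continuous_map (top_of_set ?Q) X (f \<circ> T)"
    by (rule continuous_map_compose)
  obtain G where G: "primitive_over X A w ?Q (f \<circ> T) G"
    using primitive_over_square_exists[OF at w q] by blast
  have integral: "path_integral X A w (f \<circ> T \<circ> k) = G (k 1) - G (k 0)"
    if k: "continuous_on {0..1} k" "k ` {0..1} \<subseteq> ?Q" for k
  proof -
    have "continuous_map (top_of_set {0..1}) (top_of_set ?Q) k"
      using k by auto
    then have "continuous_map (top_of_set {0..1}) X (f \<circ> T \<circ> k)"
      using q by (rule continuous_map_compose)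
    from path_integral_eq[OF at this primitive_over_compose[OF G k]] show ?thesis by simp
  qed
  have face: "path_integral X A w (simplex_path (singular_face 2 m f)) = G (k 1) - G (k 0)"
    if k: "continuous_on {0..1} k" "k ` {0..1} \<subseteq> ?Q"
      and eq: "\<And>u. u \<in> {0..1} \<Longrightarrow>
        simplical_face m (\<lambda>i. if i = 0 then 1 - u else if i = 1 then u else 0) = T (k u)"
    for k m
  proof -
    have "path_integral X A w (simplex_path (singular_face 2 m f)) = path_integral X A w (f \<circ> T \<circ> k)"
      by (rule path_integral_cong)
        (use standard_simplex_segment eq in \<open>simp add: simplex_path_def singular_face_def\<close>)
    then show ?thesis using integral[OF k] by simp
  qed
  \<comment> \<open>Face \<open>m\<close> omits vertex \<open>m\<close>, so the faces 0, 1, 2 come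
    from the sides \<open>x = 1\<close>, \<open>y = 1\<close> and \<open>y = 0\<close>, each run
    through in the direction of increasing parameter.\<close>
  have f0: "path_integral X A w (simplex_path (singular_face 2 0 f)) = G (1, 1) - G (1, 0)"
    by (rule face[where k = "\<lambda>u. (1, u)"])
      (auto intro!: continuous_intros simp: simplical_face_def T_def fun_eq_iff)
  have f1: "path_integral X A w (simplex_path (singular_face 2 1 f)) = G (1, 1) - G (0, 1)"
    by (rule face[where k = "\<lambda>u. (u, 1)"])
      (auto intro!: continuous_intros simp: simplical_face_def T_def fun_eq_iff)
  have f2: "path_integral X A w (simplex_path (singular_face 2 2 f)) = G (1, 0) - G (0, 0)"
    by (rule face[where k = "\<lambda>u. (u, 0)"])
      (auto intro!: continuous_intros simp: simplical_face_def T_def fun_eq_iff)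
  \<comment> \<open>The alternating sum over the faces is the increment along the collapsed side.
    The path there is constant, hence also the image of a parameter path resting at the corner
    \<open>(0, 0)\<close>, whose increment is trivially 0.\<close>
  have "G (0, 1) - G (0, 0) = path_integral X A w (f \<circ> T \<circ> (\<lambda>u. (0, u)))"
    by (rule integral[symmetric]) (auto intro!: continuous_intros)
  also have "f \<circ> T \<circ> (\<lambda>u. (0, u)) = f \<circ> T \<circ> (\<lambda>u. (0, 0))"
    by (auto simp: T_def fun_eq_iff intro!: arg_cong[of _ _ f])
  also have "path_integral X A w (f \<circ> T \<circ> (\<lambda>u. (0, 0))) = G (0, 0) - G (0, 0)"
    by (rule integral) auto
  finally have "G (0, 1) = G (0, 0)" by simp
  then show ?thesis
    by (simp add: chain_boundary_of numeral_2_eq_2 period_add period_diff period_minus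
        f0 f1[unfolded One_nat_def] f2[unfolded numeral_2_eq_2] f0[unfolded numeral_2_eq_2]
        f1[unfolded One_nat_def numeral_2_eq_2])
qed

text \<open>The difference of the chains bounds a 2-chain, and the period of a boundary is additive
  in that 2-chain, so the case of one triangle suffices.\<close>

lemma period_homologous:
  assumes at: "complex_atlas X A" and w: "holomorphic_differential A w"
    and "homologous X c d"
  shows "period X A c w = period X A d w"
proof -
  obtain e where e: "singular_chain 2 X e" "chain_boundary 2 e = c - d"
    using assms(3) unfolding homologous_rel_def singular_boundary by (auto simp: numeral_2_eq_2)
  from e(1) have "period X A (chain_boundary 2 e) w = 0"
    unfolding singular_chain_def
  proof (induction e rule: frag_induction)
    case (one f)
    then show ?case using period_boundary_simplex[OF at w] by simp
  qed (simp_all add: chain_boundary_diff period_diff)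
  then show ?thesis
    using e(2) by (simp add: period_diff)
qed

section \<open>Homology relations between cycles\<close>

lemma homologous_chain_map:
  assumes "homologous X c d" "continuous_map X Y f"
  shows "homologous Y (chain_map 1 f c) (chain_map 1 f d)"
proof -
  obtain e where e: "singular_chain 2 X e" "chain_boundary 2 e = c - d"
    using assms(1) unfolding homologous_rel_def singular_boundary by (auto simp: numeral_2_eq_2)
  have "chain_boundary 2 (chain_map 2 f e) = chain_map 1 f c - chain_map 1 f d"
    using chain_boundary_chain_map[OF e(1)] e(2) by (simp add: chain_map_diff)
  moreover have "singular_chain 2 Y (chain_map 2 f e)"
    using e(1) assms(2) by (rule singular_chain_chain_map)
  ultimately show ?thesis
    unfolding homologous_rel_def singular_boundary by (auto simp: numeral_2_eq_2)
qed

lemma homologous_minus: "homologous X c d \<Longrightarrow> homologous X (- c) (- d)"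
  using homologous_rel_diff[of 1 X "{}" 0 0 c d] by simp

lemma symplectic_basis_homologous_imp_eq:
  assumes basis: "symplectic_basis X A g a b" and ij: "i < g" "j < g"
    and hom: "homologous X (a i) (a j)"
  shows "i = j"
proof (rule ccontr)
  assume ne: "i \<noteq> j"
  \<comment> \<open>The combination with these coefficients is \<open>a i - a j\<close>; for
    distinct indices the coefficient at \<open>i\<close> is 1, contradicting independence.\<close>
  let ?k = "\<lambda>m. (if m = i then 1 else 0) - (if m = j then 1 else 0) :: int"
  have "cycle_combination g a b ?k (\<lambda>_. 0) = (\<Sum>m<g. (if m = i then a i else 0) - (if m = j then a j else 0))"
    unfolding cycle_combination_def by (rule sum.cong) (auto simp: ne)
  also have "\<dots> = a i - a j"
    using ij by (simp add: sum_subtractf)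
  finally have comb: "homologous X (cycle_combination g a b ?k (\<lambda>_. 0)) 0"
    using hom by (simp add: homologous_rel_def)
  have "\<forall>k l. homologous X (cycle_combination g a b k l) 0 \<longrightarrow> (\<forall>j<g. k j = 0 \<and> l j = 0)"
    using basis unfolding symplectic_basis_def by (elim conjE)
  from mp[OF spec[OF spec[OF this, of ?k], of "\<lambda>_. 0"] comb] have "?k i = 0"
    using ij(1) by blast
  then show False using ne by simp
qed

section \<open>Reality of the period matrices\<close>

lemma symplectic_basis_singular_chain:
  assumes "symplectic_basis X A g a b" "j < g"
  shows "singular_chain 1 X (a j)" "singular_chain 1 X (b j)"
proof -
  have "\<forall>j<g. cycle X (a j) \<and> cycle X (b j)"
    using assms(1) unfolding symplectic_basis_def by (elim conjE)
  then show "singular_chain 1 X (a j)" "singular_chain 1 X (b j)"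
    using assms(2) by (simp_all add: singular_cycle)
qed

text \<open>Since the \<open>g\<close> normalized differentials are linearly independent, they span a space of
  dimension \<open>g\<close>; no bilinear relations are needed. The case \<open>g = 0\<close> is excluded because the
  dimension of an infinite-dimensional space is \<open>0\<close> by convention.\<close>

lemma holomorphic_differential_eq_zero_if_a_periods_zero:
  assumes at: "complex_atlas X A" and genus: "genus A = g" and g: "0 < g"
    and a: "\<And>j. j < g \<Longrightarrow> singular_chain 1 X (a j)"
    and w: "normalized_differentials X A g a w"
    and u: "holomorphic_differential A u" "\<And>j. j < g \<Longrightarrow> period X A (a j) u = 0"
  shows "u = 0"
proof -
  interpret vs: vector_space "scale_differential :: complex \<Rightarrow> 'a differential \<Rightarrow> 'a differential"
    by (rule vector_space_scale_differential)
  let ?V = "Collect (holomorphic_differential A)"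
  let ?c = "2 * of_real pi * \<i> :: complex"
  have c: "?c \<noteq> 0" by simp
  have hol: "holomorphic_differential A (w i)" if "i < g" for i
    using w that unfolding normalized_differentials_def by blast
  have per: "period X A (a j) (w i) = (if i = j then ?c else 0)" if "i < g" "j < g" for i j
    using w that unfolding normalized_differentials_def by blast
  note add = period_add_differential[OF at a] and scale = period_scale_differential[OF at a]
  have period0: "period X A (a j) 0 = 0" if "j < g" for j
    using scale[OF that holomorphic_differential_zero, of 0] by simp
  note closed = holomorphic_differential_zero holomorphic_differential_add
    holomorphic_differential_scale
  define S where "S = w ` {..<g}"
  have inj: "inj_on w {..<g}"
    using per c by (intro inj_onI) (metis lessThan_iff)
  then have S: "finite S" "card S = g"
    by (simp_all add: S_def card_image)
  have S_V: "S \<subseteq> ?V" using hol by (auto simp: S_def)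
  have "vs.independent S"
    unfolding vs.dependent_def
  proof
    assume "\<exists>v\<in>S. v \<in> vs.span (S - {v})"
    then obtain i where i: "i < g" "w i \<in> vs.span (S - {w i})"
      by (auto simp: S_def)
    \<comment> \<open>The remaining \<open>w j\<close> have \<open>a i\<close>-period 0, and so has
      their span, whereas \<open>w i\<close> has period 2 pi i. Holomorphy is carried along because
      additivity of periods is established for holomorphic differentials.\<close>
    have "holomorphic_differential A (w i) \<and> period X A (a i) (w i) = 0"
      using i(2)
    proof (rule vs.span_induct)
      show "vs.subspace {v. holomorphic_differential A v \<and> period X A (a i) v = 0}"
        unfolding vs.subspace_def using i(1) by (simp add: closed period0 add scale)
      fix v assume "v \<in> S - {w i}"
      then show "holomorphic_differential A v \<and> period X A (a i) v = 0"
        using hol per i(1) by (auto simp: S_def)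
    qed
    then show False using per[OF i(1,1)] c by simp
  qed
  obtain B where B: "B \<subseteq> ?V" "vs.independent B" "?V \<subseteq> vs.span B" "card B = vs.dim ?V"
    using vs.basis_exists .
  have card_B: "card B = g" using B(4) genus by (simp add: genus_def)
  then have "finite B" using g card_ge_0_finite by blast
  have "u \<in> vs.span S"
  proof (rule ccontr)
    assume "u \<notin> vs.span S"
    then have "vs.independent (insert u S)" "u \<notin> S"
      using \<open>vs.independent S\<close> vs.independent_insert vs.span_base by auto
    moreover have "insert u S \<subseteq> vs.span B"
      using S_V B(3) u(1) by blast
    ultimately have "card (insert u S) \<le> g"
      using vs.independent_span_bound[OF \<open>finite B\<close>] card_B by blast
    then show False using S \<open>u \<notin> S\<close> by simp
  qed
  \<comment> \<open>Every element of the span is recovered from its own a-periods divided by 2 pi i.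
    In this form the claim is stable under linear operations, and vanishing periods give
    \<open>u = 0\<close> at once.\<close>
  then have "holomorphic_differential A u \<and>
      u = (\<Sum>i<g. scale_differential (period X A (a i) u / ?c) (w i))"
  proof (rule vs.span_induct)
    show "vs.subspace {v. holomorphic_differential A v \<and>
        v = (\<Sum>i<g. scale_differential (period X A (a i) v / ?c) (w i))}"
      unfolding vs.subspace_def
    proof (intro conjI ballI allI; clarify)
      show "holomorphic_differential A 0 \<and>
          0 = (\<Sum>i<g. scale_differential (period X A (a i) 0 / ?c) (w i))"
        using closed period0 by simp
    next
      fix v v'
      assume v: "holomorphic_differential A v"
          "v = (\<Sum>i<g. scale_differential (period X A (a i) v / ?c) (w i))"
        and v': "holomorphic_differential A v'"
          "v' = (\<Sum>i<g. scale_differential (period X A (a i) v' / ?c) (w i))"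
      have "(\<Sum>i<g. scale_differential (period X A (a i) (v + v') / ?c) (w i)) =
          (\<Sum>i<g. scale_differential (period X A (a i) v / ?c) (w i)) +
          (\<Sum>i<g. scale_differential (period X A (a i) v' / ?c) (w i))"
        unfolding sum.distrib[symmetric]
        by (rule sum.cong) (simp_all add: add v(1) v'(1) add_divide_distrib vs.scale_left_distrib)
      then show "holomorphic_differential A (v + v') \<and>
          v + v' = (\<Sum>i<g. scale_differential (period X A (a i) (v + v') / ?c) (w i))"
        using closed(2) v v' by metis
    next
      fix k v
      assume v: "holomorphic_differential A v"
          "v = (\<Sum>i<g. scale_differential (period X A (a i) v / ?c) (w i))"
      have "(\<Sum>i<g. scale_differential (period X A (a i) (scale_differential k v) / ?c) (w i)) =
          scale_differential k (\<Sum>i<g. scale_differential (period X A (a i) v / ?c) (w i))"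
        unfolding vs.scale_sum_right
        by (rule sum.cong) (simp_all add: scale v(1))
      then show "holomorphic_differential A (scale_differential k v) \<and> scale_differential k v =
          (\<Sum>i<g. scale_differential (period X A (a i) (scale_differential k v) / ?c) (w i))"
        using closed(3) v by metis
    qed
  next
    fix v assume "v \<in> S"
    then obtain i where i: "i < g" "v = w i" by (auto simp: S_def)
    have "(\<Sum>j<g. scale_differential (period X A (a j) (w i) / ?c) (w j)) =
        (\<Sum>j<g. if j = i then w i else 0)"
      by (rule sum.cong) (use per[OF i(1)] c in auto)
    also have "\<dots> = w i" using i(1) by simp
    finally show "holomorphic_differential A v \<and>
        v = (\<Sum>i<g. scale_differential (period X A (a i) v / ?c) (w i))"
      using hol i by simp
  qed
  then have "u = (\<Sum>i<g. scale_differential (period X A (a i) u / ?c) (w i))" by blast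
  also have "\<dots> = 0" using u(2) by simp
  finally show ?thesis .
qed

lemma cnj_period_normalized_differential:
  assumes at: "complex_atlas X A" and anti: "antiholomorphic_map X A X A \<tau>"
    and genus: "genus A = g" and basis: "symplectic_basis X A g a b"
    and t: "tau_adapted X \<tau> g h t a b" and w: "normalized_differentials X A g a w"
    and ij: "i < g" "j < g"
  shows "cnj (period X A (b j) (w i)) = period X A (b (t j)) (w (t i))"
proof -
  have t_lt: "t k < g" if "k < g" for k
    using t that unfolding tau_adapted_def by (metis lessThan_iff permutes_in_image)
  have t_inv: "t (t k) = k" if "k < g" for k
    using t that unfolding tau_adapted_def by blast
  have tau: "homologous X (chain_map 1 \<tau> (a k)) (a (t k))"
    "homologous X (chain_map 1 \<tau> (b k)) (- b (t k))" if "k < g" for k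
    using t that unfolding tau_adapted_def by blast+
  have hol: "holomorphic_differential A (w k)" if "k < g" for k
    using w that unfolding normalized_differentials_def by blast
  have per: "period X A (a l) (w k) = (if k = l then 2 * of_real pi * \<i> else 0)"
    if "k < g" "l < g" for k l
    using w that unfolding normalized_differentials_def by blast
  note chain = symplectic_basis_singular_chain[OF basis]
  let ?\<eta> = "conjugate_pullback A A \<tau> (w i)"
  have \<eta>: "holomorphic_differential A ?\<eta>"
    using holomorphic_differential_conjugate_pullback[OF at at anti hol[OF ij(1)]] .
  note pullback = period_conjugate_pullback[OF at at anti hol[OF ij(1)]]
  note wti = hol[OF t_lt[OF ij(1)]]
  have "?\<eta> + w (t i) = 0"
  proof (rule holomorphic_differential_eq_zero_if_a_periods_zero[OF at genus _ _ w])
    show "0 < g" using ij by simp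
    show "singular_chain 1 X (a k)" if "k < g" for k using chain(1)[OF that] .
    show "holomorphic_differential A (?\<eta> + w (t i))"
      using \<eta> wti by (rule holomorphic_differential_add)
    fix k assume k: "k < g"
    have "period X A (a k) ?\<eta> = cnj (period X A (a (t k)) (w i))"
      using pullback[OF chain(1)[OF k]] period_homologous[OF at hol[OF ij(1)] tau(1)[OF k]] by simp
    \<comment> \<open>As \<open>t\<close> is an involution, both terms can be nonzero only for
      \<open>k = t i\<close>; there they are the conjugate of 2 pi i and 2 pi i itself, and
      cancel.\<close>
    then show "period X A (a k) (?\<eta> + w (t i)) = 0"
      using period_add_differential[OF at chain(1)[OF k] \<eta> wti] per[OF ij(1) t_lt[OF k]]
        per[OF t_lt[OF ij(1)] k] t_inv[OF ij(1)] t_inv[OF k] by auto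
  qed
  moreover have tj: "t j < g" using t_lt ij(2) by blast
  moreover have "period X A (b (t j)) 0 = 0"
    using period_scale_differential[OF at chain(2)[OF tj] holomorphic_differential_zero, of 0]
    by (simp add: scale_differential_def zero_fun_def)
  ultimately have "period X A (b (t j)) ?\<eta> + period X A (b (t j)) (w (t i)) = 0"
    using period_add_differential[OF at chain(2)[OF tj] \<eta> wti] by simp
  \<comment> \<open>Up to homology \<open>\<tau>\<close> carries \<open>b (t j)\<close> to
    \<open>- b j\<close>; this minus sign compensates the one from the a-periods.\<close>
  moreover have "period X A (b (t j)) ?\<eta> = cnj (- period X A (b j) (w i))"
    using pullback[OF chain(2)[OF tj]] period_homologous[OF at hol[OF ij(1)] tau(2)[OF tj]]
      t_inv[OF ij(2)] by (simp add: period_minus)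
  ultimately show ?thesis by (simp add: eq_neg_iff_add_eq_0 add.commute)
qed

section \<open>Compatibility of the two index permutations\<close>

lemma permutations_commute:
  assumes \<sigma>: "continuous_map X X \<sigma>" and \<tau>: "continuous_map X X \<tau>"
    and comm: "\<And>x. x \<in> topspace X \<Longrightarrow> \<sigma> (\<tau> x) = \<tau> (\<sigma> x)"
    and basis: "symplectic_basis X A g a b"
    and s: "s permutes {..<g}" "sigma_adapted X \<sigma> g s a b"
    and t: "tau_adapted X \<tau> g h t a b"
    and j: "j < g"
  shows "t (s j) = s (t j)"
proof -
  have lt: "t k < g" "s k < g" if "k < g" for k
    using t s(1) that unfolding tau_adapted_def by (metis lessThan_iff permutes_in_image)+
  have tau: "homologous X (chain_map 1 \<tau> (a k)) (a (t k))" if "k < g" for k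
    using t that unfolding tau_adapted_def by blast
  have sigma: "homologous X (chain_map 1 \<sigma> (a k)) (- a (s k))" if "k < g" for k
    using s(2) that unfolding sigma_adapted_def by blast
  have "homologous X (chain_map 1 \<sigma> (chain_map 1 \<tau> (a j))) (chain_map 1 \<sigma> (a (t j)))"
    using homologous_chain_map[OF tau[OF j] \<sigma>] .
  then have 1: "homologous X (chain_map 1 \<sigma> (chain_map 1 \<tau> (a j))) (- a (s (t j)))"
    using sigma[OF lt(1)[OF j]] homologous_rel_trans by blast
  have "homologous X (chain_map 1 \<tau> (chain_map 1 \<sigma> (a j))) (- chain_map 1 \<tau> (a (s j)))"
    using homologous_chain_map[OF sigma[OF j] \<tau>] by (simp add: chain_map_minus)
  then have 2: "homologous X (chain_map 1 \<tau> (chain_map 1 \<sigma> (a j))) (- a (t (s j)))"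
    using homologous_minus[OF tau[OF lt(2)[OF j]]] homologous_rel_trans by blast
  \<comment> \<open>The involutions are known to commute on the points of \<open>X\<close>; this is
    enough since the simplices of a chain in \<open>X\<close> take their values there.\<close>
  have "chain_map 1 (\<sigma> \<circ> \<tau>) (a j) = chain_map 1 (\<tau> \<circ> \<sigma>) (a j)"
    by (rule chain_map_eq[OF symplectic_basis_singular_chain(1)[OF basis j]]) (simp add: comm)
  then have "chain_map 1 \<sigma> (chain_map 1 \<tau> (a j)) = chain_map 1 \<tau> (chain_map 1 \<sigma> (a j))"
    by (simp add: chain_map_compose)
  with 1 2 have "homologous X (- a (t (s j))) (- a (s (t j)))"
    by (metis homologous_rel_sym homologous_rel_trans)
  from homologous_minus[OF this] have "homologous X (a (t (s j))) (a (s (t j)))"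
    by simp
  then show ?thesis
    using symplectic_basis_homologous_imp_eq[OF basis] lt j by blast
qed

text \<open>The pairs \<open>(i, i + h)\<close> are permuted by \<open>t\<close>, so the Prym
  differentials inherit the reality of the \<open>w i\<close>. The factor 1/2 depends only on the
  side of \<open>g\<^sub>\<sigma>\<close> on which the column index lies, and \<open>t\<close>
  respects the two sides.\<close>

lemma entrywise_real_prym_matrix:
  assumes real: "\<And>i j. i < g \<Longrightarrow> j < g \<Longrightarrow> cnj (period X A (b j) (w i)) = period X A (b (t j)) (w (t i))"
    and at: "complex_atlas X A" and b: "\<And>j. j < g \<Longrightarrow> singular_chain 1 X (b j)"
    and w: "\<And>i. i < g \<Longrightarrow> holomorphic_differential A (w i)"
    and g: "g = h + g\<^sub>\<sigma>" "g\<^sub>\<sigma> \<le> h"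
    and t_lt: "\<And>j. j < h \<Longrightarrow> t j < h"
    and t_pulled: "\<And>j. j < h \<Longrightarrow> t j < g\<^sub>\<sigma> \<longleftrightarrow> j < g\<^sub>\<sigma>"
    and t_shift: "\<And>j. j < g\<^sub>\<sigma> \<Longrightarrow> t (j + h) = t j + h"
  shows "entrywise_real h t (prym_matrix X A h g\<^sub>\<sigma> b w)"
proof -
  have "cnj (period X A (b q) (prym_differential h g\<^sub>\<sigma> w p)) =
      period X A (b (t q)) (prym_differential h g\<^sub>\<sigma> w (t p))" if pq: "p < h" "q < h" for p q
  proof (cases "p < g\<^sub>\<sigma>")
    case True
    then have tp: "t p < g\<^sub>\<sigma>" using t_pulled pq(1) by simp
    have lt: "p < g" "p + h < g" "t p < g" "t p + h < g" "q < g" "t q < g"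
      using True tp pq t_lt g by (simp_all add: trans_less_add1)
    have "cnj (period X A (b q) (w p + w (p + h))) =
        period X A (b (t q)) (w (t p)) + period X A (b (t q)) (w (t p + h))"
      using period_add_differential[OF at b[OF lt(5)] w[OF lt(1)] w[OF lt(2)]]
        real[OF lt(1,5)] real[OF lt(2,5)] t_shift[OF True] by simp
    also have "\<dots> = period X A (b (t q)) (w (t p) + w (t p + h))"
      using period_add_differential[OF at b[OF lt(6)] w[OF lt(3)] w[OF lt(4)]] by simp
    finally show ?thesis
      using True tp by (simp add: prym_differential_def)
  next
    case False
    then show ?thesis
      using t_pulled[OF pq(1)] pq g by (simp add: prym_differential_def real)
  qed
  then show ?thesis
    using t_lt t_pulled by (simp add: entrywise_real_def prym_matrix_def)
qed

section \<open>Permutation matrices of involutions and the three reality conditions\<close>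

lemma perm_matrix_conjugate_index:
  assumes t: "\<And>j. j < h \<Longrightarrow> t j < h" "\<And>j. j < h \<Longrightarrow> t (t j) = j"
    and M: "M \<in> carrier_mat h h" and pq: "p < h" "q < h"
  shows "(perm_matrix h t * M * perm_matrix h t) $$ (p, q) = M $$ (t p, t q)"
    and "(perm_matrix h t *\<^sub>v Matrix.col M (t q)) $ p = M $$ (t p, t q)"
proof -
  \<comment> \<open>Row \<open>p\<close> of the permutation matrix has its only 1 in column
    \<open>t p\<close>, because \<open>t\<close> is its own inverse below \<open>h\<close>;
    multiplication from the left thus selects row \<open>t p\<close>.\<close>
  have eq: "p = t k \<longleftrightarrow> k = t p" if "k < h" for k
    using t that pq(1) by metis
  have row: "(\<Sum>k = 0..<h. (if p = t k then 1 else 0) * f k) = f (t p)" for f :: "nat \<Rightarrow> complex"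
  proof -
    have "(\<Sum>k = 0..<h. (if p = t k then 1 else 0) * f k) = (\<Sum>k = 0..<h. if k = t p then f k else 0)"
      by (rule sum.cong) (auto simp: eq)
    then show ?thesis using t(1)[OF pq(1)] by simp
  qed
  have PM: "(perm_matrix h t * M) $$ (p, k) = M $$ (t p, k)" if "k < h" for k
    using M that pq t(1) row[of "\<lambda>l. M $$ (l, k)"]
    by (simp add: perm_matrix_def scalar_prod_def)
  have "(perm_matrix h t * M * perm_matrix h t) $$ (p, q) =
      (\<Sum>k = 0..<h. (perm_matrix h t * M) $$ (p, k) * (if k = t q then 1 else 0))"
    using M pq by (simp add: perm_matrix_def scalar_prod_def)
  also have "\<dots> = (\<Sum>k = 0..<h. if k = t q then M $$ (t p, k) else 0)"
    by (rule sum.cong) (auto simp: PM)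
  also have "\<dots> = M $$ (t p, t q)" using t(1)[OF pq(2)] by simp
  finally show "(perm_matrix h t * M * perm_matrix h t) $$ (p, q) = M $$ (t p, t q)" .
  show "(perm_matrix h t *\<^sub>v Matrix.col M (t q)) $ p = M $$ (t p, t q)"
    using M pq t(1) row[of "\<lambda>l. M $$ (l, t q)"]
    by (simp add: perm_matrix_def scalar_prod_def)
qed

text \<open>Each condition is an equality of entries, and the right-hand sides all have the entry
  \<open>M $$ (t p, t q)\<close> in row \<open>p\<close> and column \<open>q\<close>; the entrywise
  form serves as the hub.\<close>

lemma reality_conditions_equivalent:
  assumes t: "\<And>j. j < h \<Longrightarrow> t j < h" "\<And>j. j < h \<Longrightarrow> t (t j) = j"
    and M: "M \<in> carrier_mat h h"
  shows "matrix_real h t M \<longleftrightarrow> entrywise_real h t M"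
    and "columnwise_real h t M \<longleftrightarrow> entrywise_real h t M"
proof -
  note index = perm_matrix_conjugate_index[OF t M]
  have dims: "dim_row (perm_matrix h t) = h" "dim_col (perm_matrix h t) = h"
    by (simp_all add: perm_matrix_def)
  have "matrix_real h t M \<longleftrightarrow> (\<forall>p<h. \<forall>q<h.
      map_mat cnj M $$ (p, q) = (perm_matrix h t * M * perm_matrix h t) $$ (p, q))"
    unfolding matrix_real_def mat_eq_iff using M dims by auto
  then show "matrix_real h t M \<longleftrightarrow> entrywise_real h t M"
    using M index(1) by (simp add: entrywise_real_def)
  have "columnwise_real h t M \<longleftrightarrow> (\<forall>q<h. \<forall>p<h.
      map_vec cnj (Matrix.col M q) $ p = (perm_matrix h t *\<^sub>v Matrix.col M (t q)) $ p)"
    unfolding columnwise_real_def vec_eq_iff using M dims by auto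
  then show "columnwise_real h t M \<longleftrightarrow> entrywise_real h t M"
    using M index(2) by (auto simp: entrywise_real_def)
qed

theorem lemma3p2:
  fixes X :: "'a topology" and A :: "'a chart set"
    and Y :: "'b topology" and B :: "'b chart set"
    and \<sigma> \<tau> :: "'a \<Rightarrow> 'a" and \<pi> :: "'a \<Rightarrow> 'b"
    and g h g\<^sub>\<sigma> n :: nat
    and s t :: "nat \<Rightarrow> nat"
    and a b :: "nat \<Rightarrow> 'a chain"
    and w :: "nat \<Rightarrow> 'a differential"
    and P :: "complex Matrix.mat"
  assumes curve: "real_curve_with_involution X A \<sigma> \<tau>"
    and sep: "separating X \<tau>"
    and quotient: "quotient_surface X A \<sigma> Y B \<pi>"
    and genera: "genus A = g" "genus B = g\<^sub>\<sigma>"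
    and branch: "divisor_degree Y (branch_divisor X A B \<pi>) = 2 * n"
    and h: "int h = int g\<^sub>\<sigma> + int n - 1" "g = h + g\<^sub>\<sigma>"
    and basis: "symplectic_basis X A g a b"
    and s: "sigma_permutation g h g\<^sub>\<sigma> s" "sigma_adapted X \<sigma> g s a b"
    and pullback: "pulled_back Y B \<pi> h g\<^sub>\<sigma> a b"
    and t: "tau_adapted X \<tau> g h t a b"
    and w: "normalized_differentials X A g a w"
    and P: "P = prym_matrix X A h g\<^sub>\<sigma> b w"
  shows "(\<forall>M \<in> carrier_mat h h.
            (entrywise_real h t M \<longleftrightarrow> matrix_real h t M) \<and>
            (matrix_real h t M \<longleftrightarrow> columnwise_real h t M)) \<and>
         entrywise_real h t P \<and> matrix_real h t P \<and> columnwise_real h t P"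
proof -
  have at: "complex_atlas X A" and \<sigma>: "continuous_map X X \<sigma>" and \<tau>: "continuous_map X X \<tau>"
    and anti: "antiholomorphic_map X A X A \<tau>"
    and comm: "\<And>x. x \<in> topspace X \<Longrightarrow> \<sigma> (\<tau> x) = \<tau> (\<sigma> x)"
    using curve unfolding real_curve_with_involution_def compact_riemann_surface_def
      holomorphic_map_def antiholomorphic_map_def by blast+
  have s_perm: "s permutes {..<g}" and s_pulled: "\<And>j. j < g\<^sub>\<sigma> \<Longrightarrow> s j = h + j \<and> s (h + j) = j"
    and s_fixed: "\<And>j. g\<^sub>\<sigma> \<le> j \<Longrightarrow> j < h \<Longrightarrow> s j = j"
    using s(1) unfolding sigma_permutation_def by blast+
  have t_inv: "t (t j) = j" if "j < g" for j
    using t that unfolding tau_adapted_def by blast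
  have "t ` {..<h} = {..<h}"
    using t unfolding tau_adapted_def by blast
  then have t_lt: "t j < h" if "j < h" for j
    using that by blast
  have comm_st: "t (s j) = s (t j)" if "j < g" for j
    using permutations_commute[OF \<sigma> \<tau> comm basis s_perm s(2) t that] .
  have real: "entrywise_real h t P"
  \<comment> \<open>For \<open>h = 0\<close> there are no entries to compare, and an index would
    coincide with its own partner \<open>h + j\<close>.\<close>
  proof (cases "h = 0")
    case False
    have "g\<^sub>\<sigma> \<le> h"
    proof (rule ccontr)
      assume "\<not> g\<^sub>\<sigma> \<le> h"
      \<comment> \<open>The index \<open>h\<close> would lie in the first block and also be the
        partner of 0, which gives it two different images under \<open>s\<close>.\<close>
      then have "s h = h + h" "s (h + 0) = 0"
        using s_pulled[of h] s_pulled[of 0] by simp_all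
      then show False using False by simp
    qed
    have shift: "t j < g\<^sub>\<sigma> \<and> t (j + h) = t j + h" if j: "j < g\<^sub>\<sigma>" for j
    proof -
      have eq: "t (h + j) = s (t j)"
        using comm_st[of j] s_pulled[OF j] j h(2) by simp
      \<comment> \<open>An involution that preserves the indices below \<open>h\<close> cannot bring
        a larger one down.\<close>
      have "\<not> t (h + j) < h"
        using t_lt[of "t (h + j)"] t_inv[of "h + j"] j h(2) by auto
      moreover have "t j < h" using t_lt j \<open>g\<^sub>\<sigma> \<le> h\<close> by simp
      \<comment> \<open>Otherwise \<open>s\<close> would fix \<open>t j\<close>, and
        \<open>t (h + j) = t j\<close> would lie below \<open>h\<close>.\<close>
      ultimately have "t j < g\<^sub>\<sigma>"
        using s_fixed[of "t j"] eq by force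
      then show ?thesis using eq s_pulled[of "t j"] by (simp add: add.commute)
    qed
    \<comment> \<open>The forward implication is \<open>shift\<close> applied to \<open>t j\<close>,
      since \<open>t (t j) = j\<close>.\<close>
    have pulled: "t j < g\<^sub>\<sigma> \<longleftrightarrow> j < g\<^sub>\<sigma>" if "j < h" for j
      using shift[of j] shift[of "t j"] t_inv[of j] that h(2) by auto
    show ?thesis
      unfolding P
    proof (rule entrywise_real_prym_matrix[where g = g])
      show "cnj (period X A (b j) (w i)) = period X A (b (t j)) (w (t i))" if "i < g" "j < g" for i j
        using cnj_period_normalized_differential[OF at anti genera(1) basis t w that] .
      show "singular_chain 1 X (b j)" if "j < g" for j
        using symplectic_basis_singular_chain(2)[OF basis that] .
      show "holomorphic_differential A (w i)" if "i < g" for i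
        using w that unfolding normalized_differentials_def by blast
    qed (use at h(2) \<open>g\<^sub>\<sigma> \<le> h\<close> t_lt pulled shift in auto)
  qed (simp add: entrywise_real_def)
  have t_inv_h: "t (t j) = j" if "j < h" for j
    using t_inv that h(2) by simp
  have "P \<in> carrier_mat h h"
    by (simp add: P prym_matrix_def)
  then show ?thesis
    using real reality_conditions_equivalent[OF t_lt t_inv_h] by blast
qed

end
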